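(* There is a polynomial-time $O(n^{4/5})$-approximation algorithm for the Densest $k$-Subhypergraph problem in $3$-uniform hypergraphs with $n$ vertices.
   Context: A $3$-uniform hypergraph $H=(V,E)$ has a finite vertex set $V$, $|V|=n$, and a collection $E$ of $3$-element subsets of $V$. Densest $k$-Subhypergraph: given $H$ and integer $k$, find $W\subseteq V$ with $|W|=k$ maximizing the number of hyperedges $e\subseteq W$; an $\rho$-approximation returns such a $W$ containing at least a $1/\rho$ fraction of the optimal number. *)

theory Defs
  imports Complex_Main "HOL-Library.Landau_Symbols" "HOL-Computational_Algebra.Polynomial"
begin

section \<open>Densest k-Subhypergraph\<close>

definition uniform3_hypergraph :: "'a set \<Rightarrow> 'a set set \<Rightarrow> bool" where
  "uniform3_hypergraph V E \<longleftrightarrow> finite V \<and> (\<forall>e\<in>E. e \<subseteq> V \<and> card e = 3)"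

definition induced_edges :: "'a set set \<Rightarrow> 'a set \<Rightarrow> nat" where
  "induced_edges E W = card {e \<in> E. e \<subseteq> W}"

definition densest_opt :: "'a set \<Rightarrow> 'a set set \<Rightarrow> nat \<Rightarrow> nat" where
  "densest_opt V E k = Max {induced_edges E W | W. W \<subseteq> V \<and> card W = k}"

definition approx_solution :: "real \<Rightarrow> 'a set \<Rightarrow> 'a set set \<Rightarrow> nat \<Rightarrow> 'a set \<Rightarrow> bool" where
  "approx_solution \<rho> V E k W \<longleftrightarrow>
     W \<subseteq> V \<and> card W = k \<and> real (induced_edges E W) \<ge> (1 / \<rho>) * real (densest_opt V E k)"


section \<open>A random access machine language with uniform costs\<close>

text \<open>
  Algorithms are deterministic programs over natural-number registers and indexed arrays; array
  indices may be computed, so memory is randomly accessible. The arithmetic is addition and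
  truncated subtraction only: one unit of cost then at most doubles the largest number in memory,
  so numbers have bit length linear in the bit length of the input plus the cost, and polynomial
  cost coincides with polynomial time on a Turing machine. (Unit-cost multiplication would break
  this.)
\<close>

type_synonym vname = string

record state =
  reg :: "vname \<Rightarrow> nat"
  arr :: "vname \<Rightarrow> nat \<Rightarrow> nat"

datatype aexp =
    Num nat
  | Var vname
  | Cell vname aexp
  | Plus aexp aexp
  | Minus aexp aexp

datatype bexp =
    Less aexp aexp
  | Eq aexp aexp
  | Not bexp
  | And bexp bexp

datatype com =
    Skip
  | Assign vname aexp
  | Store vname aexp aexp
  | Seq com com
  | If bexp com com
  | While bexp com

primrec aval :: "aexp \<Rightarrow> state \<Rightarrow> nat" where
  "aval (Num n) s = n"
| "aval (Var x) s = reg s x"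
| "aval (Cell a i) s = arr s a (aval i s)"
| "aval (Plus a b) s = aval a s + aval b s"
| "aval (Minus a b) s = aval a s - aval b s"

primrec bval :: "bexp \<Rightarrow> state \<Rightarrow> bool" where
  "bval (Less a b) s \<longleftrightarrow> aval a s < aval b s"
| "bval (Eq a b) s \<longleftrightarrow> aval a s = aval b s"
| "bval (Not b) s \<longleftrightarrow> \<not> bval b s"
| "bval (And b c) s \<longleftrightarrow> bval b s \<and> bval c s"

primrec acost :: "aexp \<Rightarrow> nat" where
  "acost (Num n) = 1"
| "acost (Var x) = 1"
| "acost (Cell a i) = 1 + acost i"
| "acost (Plus a b) = 1 + acost a + acost b"
| "acost (Minus a b) = 1 + acost a + acost b"

primrec bcost :: "bexp \<Rightarrow> nat" where
  "bcost (Less a b) = 1 + acost a + acost b"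
| "bcost (Eq a b) = 1 + acost a + acost b"
| "bcost (Not b) = 1 + bcost b"
| "bcost (And b c) = 1 + bcost b + bcost c"

text \<open>\<open>exec c s t s'\<close>: started in \<open>s\<close>, the program \<open>c\<close> halts in \<open>s'\<close> after \<open>t\<close> units of cost.\<close>

inductive exec :: "com \<Rightarrow> state \<Rightarrow> nat \<Rightarrow> state \<Rightarrow> bool" where
  exec_Skip: "exec Skip s 1 s"
| exec_Assign: "exec (Assign x e) s (1 + acost e) (s\<lparr>reg := (reg s)(x := aval e s)\<rparr>)"
| exec_Store: "exec (Store a i e) s (1 + acost i + acost e)
     (s\<lparr>arr := (arr s)(a := (arr s a)(aval i s := aval e s))\<rparr>)"
| exec_Seq: "exec c1 s t1 s' \<Longrightarrow> exec c2 s' t2 s'' \<Longrightarrow> exec (Seq c1 c2) s (t1 + t2) s''"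
| exec_IfTrue: "bval b s \<Longrightarrow> exec c1 s t s' \<Longrightarrow> exec (If b c1 c2) s (1 + bcost b + t) s'"
| exec_IfFalse: "\<not> bval b s \<Longrightarrow> exec c2 s t s' \<Longrightarrow> exec (If b c1 c2) s (1 + bcost b + t) s'"
| exec_WhileFalse: "\<not> bval b s \<Longrightarrow> exec (While b c) s (1 + bcost b) s"
| exec_WhileTrue: "bval b s \<Longrightarrow> exec c s t1 s' \<Longrightarrow> exec (While b c) s' t2 s'' \<Longrightarrow>
     exec (While b c) s (1 + bcost b + t1 + t2) s''"

inductive_cases exec_SkipE: "exec Skip s t s'"
inductive_cases exec_AssignE: "exec (Assign x e) s t s'"
inductive_cases exec_StoreE: "exec (Store a i e) s t s'"
inductive_cases exec_SeqE: "exec (Seq c1 c2) s t s'"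
inductive_cases exec_IfE: "exec (If b c1 c2) s t s'"
inductive_cases exec_WhileE: "exec (While b c) s t s'"

lemma exec_deterministic:
  "exec c s t s' \<Longrightarrow> exec c s u s'' \<Longrightarrow> u = t \<and> s'' = s'"
proof (induction arbitrary: u s'' rule: exec.induct)
  case (exec_Skip s)
  then show ?case by (auto elim: exec_SkipE)
next
  case (exec_Assign x e s)
  then show ?case by (auto elim: exec_AssignE)
next
  case (exec_Store a i e s)
  then show ?case by (auto elim: exec_StoreE)
next
  case (exec_Seq c1 s t1 s' c2 t2 s3)
  from exec_Seq.prems obtain v1 r v2
    where "exec c1 s v1 r" "exec c2 r v2 s''" "u = v1 + v2"
    by (rule exec_SeqE)
  with exec_Seq.IH show ?case by metis
next
  case (exec_IfTrue b s c1 t s' c2)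
  from exec_IfTrue.prems exec_IfTrue.hyps(1) obtain v
    where "exec c1 s v s''" "u = 1 + bcost b + v"
    by (cases rule: exec_IfE) auto
  with exec_IfTrue.IH show ?case by metis
next
  case (exec_IfFalse b s c2 t s' c1)
  from exec_IfFalse.prems exec_IfFalse.hyps(1) obtain v
    where "exec c2 s v s''" "u = 1 + bcost b + v"
    by (cases rule: exec_IfE) auto
  with exec_IfFalse.IH show ?case by metis
next
  case (exec_WhileFalse b s c)
  from exec_WhileFalse.prems exec_WhileFalse.hyps show ?case
    by (cases rule: exec_WhileE) auto
next
  case (exec_WhileTrue b s c t1 s' t2 s3)
  from exec_WhileTrue.prems exec_WhileTrue.hyps(1) obtain v1 r v2
    where "exec c s v1 r" "exec (While b c) r v2 s''" "u = 1 + bcost b + v1 + v2"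
    by (cases rule: exec_WhileE) auto
  with exec_WhileTrue.IH show ?case by metis
qed


section \<open>Algorithms for Densest k-Subhypergraph\<close>

text \<open>
  A presentation of a hypergraph numbers its vertices by their position in the list \<open>vs\<close> and lists
  every hyperedge exactly once, as a triple of such positions in arbitrary order. A program sees
  only the positions, never the vertices themselves.
\<close>

definition edge_of :: "'a list \<Rightarrow> nat \<times> nat \<times> nat \<Rightarrow> 'a set" where
  "edge_of vs = (\<lambda>(a, b, c). {vs ! a, vs ! b, vs ! c})"

definition presents :: "'a list \<Rightarrow> (nat \<times> nat \<times> nat) list \<Rightarrow> 'a set \<Rightarrow> 'a set set \<Rightarrow> bool" where
  "presents vs es V E \<longleftrightarrow>
     distinct vs \<and> set vs = V \<and>
     (\<forall>(a, b, c) \<in> set es. a < length vs \<and> b < length vs \<and> c < length vs) \<and>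
     distinct (map (edge_of vs) es) \<and> set (map (edge_of vs) es) = E"

text \<open>
  Registers \<open>n\<close>, \<open>m\<close>, \<open>k\<close> hold the number of vertices, the number of hyperedges and the parameter,
  and cells \<open>3 * j\<close>, \<open>3 * j + 1\<close>, \<open>3 * j + 2\<close> of array \<open>E\<close> hold the \<open>j\<close>-th hyperedge.
\<close>

definition input_state :: "nat \<Rightarrow> (nat \<times> nat \<times> nat) list \<Rightarrow> nat \<Rightarrow> state" where
  "input_state n es k =
     \<lparr>reg = (\<lambda>_. 0)(''n'' := n, ''m'' := length es, ''k'' := k),
      arr = (\<lambda>_ _. 0)(''E'' :=
        (\<lambda>i. let xs = concat (map (\<lambda>(a, b, c). [a, b, c]) es)
             in if i < length xs then xs ! i else 0))\<rparr>"

text \<open>On halting, array \<open>W\<close> is the characteristic vector of the chosen vertex set.\<close>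

definition output_set :: "'a list \<Rightarrow> state \<Rightarrow> 'a set" where
  "output_set vs s = {vs ! i | i. i < length vs \<and> arr s ''W'' i \<noteq> 0}"

text \<open>
  The instance size is \<open>n + m\<close>, which is polynomially related to the bit length of the input, as
  all numbers in a valid input are at most \<open>max n m\<close>. Every finite hypergraph is isomorphic to one
  whose vertices are natural numbers.
\<close>

definition polynomial_time :: "com \<Rightarrow> bool" where
  "polynomial_time alg \<longleftrightarrow>
     (\<exists>p :: nat poly. \<forall>(V :: nat set) E k vs es.
        uniform3_hypergraph V E \<longrightarrow> k \<le> card V \<longrightarrow> presents vs es V E \<longrightarrow>
        (\<exists>t s'. exec alg (input_state (length vs) es k) t s' \<and>
                t \<le> poly p (length vs + length es)))"

text \<open>
  The requirement \<open>1 \<le> \<rho> n\<close> keeps \<open>1 / \<rho> n\<close> meaningful: \<open>1 / 0 = 0\<close> would make the guarantee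
  vacuous. Together with \<open>polynomial_time\<close> and determinism the guarantee holds for the unique
  halting run.
\<close>

definition approximates_densest :: "com \<Rightarrow> (nat \<Rightarrow> real) \<Rightarrow> bool" where
  "approximates_densest alg \<rho> \<longleftrightarrow>
     (\<forall>n. 1 \<le> \<rho> n) \<and>
     (\<forall>(V :: nat set) E k vs es t s'.
        uniform3_hypergraph V E \<longrightarrow> k \<le> card V \<longrightarrow> presents vs es V E \<longrightarrow>
        exec alg (input_state (length vs) es k) t s' \<longrightarrow>
        approx_solution (\<rho> (card V)) V E k (output_set vs s'))"

end

theory Submission
  imports Defs
begin

text \<open>
  Peeling protects a vertex set \<open>H\<close> and, among the hyperedges meeting \<open>H\<close>, repeatedly discards an
  unprotected vertex of least degree until \<open>k\<close> vertices remain. The algorithm returns the best of the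
  peelings with \<open>H\<close> a set of \<open>k div 2\<close> vertices of largest degree, with \<open>H\<close> each single vertex, and
  of a plain peeling with \<open>H = {}\<close> and all hyperedges.

  Let \<open>OPT\<close> be the optimum, \<open>ALG\<close> the value returned. If half of the optimal hyperedges meet the
  heavy set, peeling around it gives \<open>ALG \<ge> c OPT k / n\<close>. Otherwise some optimal vertex \<open>v\<close> outside it
  has at least \<open>1.5 OPT / k\<close> optimal hyperedges; writing \<open>D\<close> for the degree of \<open>v\<close>, peeling around \<open>v\<close>
  gives \<open>ALG \<ge> c (OPT / k)^2 / D\<close>, and as all heavy vertices have degree at least \<open>D\<close>, peeling around
  the heavy set gives \<open>ALG \<ge> c D k^3 / n^2\<close>. Both cases give \<open>ALG^2 \<ge> c OPT^2 k / n^2\<close>. The plain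
  peeling gives \<open>ALG \<ge> k / 9\<close> (or all hyperedges), and \<open>OPT \<le> k^3\<close>; eliminating \<open>k\<close> yields
  \<open>OPT^5 \<le> C n^4 ALG^5\<close>.
\<close>

section \<open>Peeling\<close>

text \<open>Hyperedges are indexed, \<open>e j\<close> being the vertex set of index
  \<open>j\<close>, so that positions in the input list can serve as hyperedges directly.\<close>

definition inside :: "('i \<Rightarrow> 'v set) \<Rightarrow> 'i set \<Rightarrow> 'v set \<Rightarrow> 'i set" where
  "inside e F R = {j \<in> F. e j \<subseteq> R}"

definition degree_in :: "('i \<Rightarrow> 'v set) \<Rightarrow> 'i set \<Rightarrow> 'v set \<Rightarrow> 'v \<Rightarrow> nat" where
  "degree_in e F R v = card {j \<in> inside e F R. v \<in> e j}"

text \<open>A relation rather than a function, so that ties may be broken arbitrarily. Once only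
  protected vertices are left any of them may go, so every size can be reached, even one below
  \<open>card H\<close>.\<close>

definition peel_step :: "('i \<Rightarrow> 'v set) \<Rightarrow> 'i set \<Rightarrow> 'v set \<Rightarrow> 'v set \<Rightarrow> 'v set \<Rightarrow> bool" where
  "peel_step e F H R R' \<longleftrightarrow>
     (\<exists>b\<in>R. R' = R - {b} \<and>
        (R - H \<noteq> {} \<longrightarrow> b \<notin> H \<and> (\<forall>u\<in>R - H. degree_in e F R b \<le> degree_in e F R u)))"

abbreviation peel :: "('i \<Rightarrow> 'v set) \<Rightarrow> 'i set \<Rightarrow> 'v set \<Rightarrow> 'v set \<Rightarrow> 'v set \<Rightarrow> bool" where
  "peel e F H \<equiv> (peel_step e F H)\<^sup>*\<^sup>*"

section \<open>Counting hyperedges under vertex removal, and plain peeling\<close>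

lemma inside_subset: "inside e F R \<subseteq> F"
  by (auto simp: inside_def)

lemma finite_inside [simp]: "finite F \<Longrightarrow> finite (inside e F R)"
  by (auto simp: inside_def)

lemma card_inside_remove:
  assumes "finite F"
  shows "card (inside e F R) = card (inside e F (R - {b})) + degree_in e F R b"
proof -
  have "inside e F R = inside e F (R - {b}) \<union> {j \<in> inside e F R. b \<in> e j}"
    by (auto simp: inside_def)
  moreover have "inside e F (R - {b}) \<inter> {j \<in> inside e F R. b \<in> e j} = {}"
    by (auto simp: inside_def)
  ultimately show ?thesis
    unfolding degree_in_def using assms
    by (metis (no_types, lifting) card_Un_disjoint finite_Un finite_inside)
qed

text \<open>Double counting of incidences; it turns every choice of a least-degree vertex into a
  bound by the average degree.\<close>

lemma sum_incidences:
  assumes "finite J" "finite A"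
  shows "(\<Sum>u\<in>A. card {j \<in> J. u \<in> e j}) = (\<Sum>j\<in>J. card (e j \<inter> A))"
proof -
  have "(\<Sum>u\<in>A. card {j \<in> J. u \<in> e j}) = (\<Sum>u\<in>A. \<Sum>j\<in>J. if u \<in> e j then 1 else 0)"
    using assms by (intro sum.cong) (auto simp: sum.If_cases Int_def)
  also have "\<dots> = (\<Sum>j\<in>J. \<Sum>u\<in>A. if u \<in> e j then 1 else 0)"
    by (rule sum.swap)
  also have "\<dots> = (\<Sum>j\<in>J. card (e j \<inter> A))"
    using assms by (intro sum.cong) (auto simp: sum.If_cases Int_def intro: arg_cong[where f = card])
  finally show ?thesis .
qed

lemma peel_subset: "peel e F H R R' \<Longrightarrow> R' \<subseteq> R"
  by (induction rule: rtranclp_induct) (auto simp: peel_step_def)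

text \<open>Dropping a vertex of degree 0 loses no hyperedge. Otherwise the least degree
  \<open>d\<close> is positive; the degrees sum to three times the number of hyperedges, so
  \<open>(card R - 3) * d\<close> is at most three times the number that survive the step, and
  \<open>d \<ge> 1\<close> gives the second alternative.\<close>

lemma card_peel_all:
  assumes "peel e F {} R0 R" "finite F" "finite R0" "inside e F R0 = F" "\<And>j. j \<in> F \<Longrightarrow> card (e j) = 3"
  shows "card (inside e F R) = card F \<or> card R \<le> 3 * card (inside e F R) + 2"
  using assms(1)
proof (induction rule: rtranclp_induct)
  case base
  then show ?case using assms by simp
next
  case (step R R')
  from step.hyps(2) obtain b where b: "b \<in> R" "R' = R - {b}"
    and mn: "\<And>u. u \<in> R \<Longrightarrow> degree_in e F R b \<le> degree_in e F R u"
    by (auto simp: peel_step_def)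
  have fR: "finite R" using peel_subset[OF step.hyps(1)] assms(3) finite_subset by blast
  have eq: "card (inside e F R) = card (inside e F R') + degree_in e F R b"
    using card_inside_remove[OF assms(2), of e R b] b by simp
  have cR: "card R = Suc (card R')" using b fR by (metis card.remove)
  show ?case
  proof (cases "degree_in e F R b = 0")
    case True
    then show ?thesis using eq step.IH cR by auto
  next
    case False
    have "card R * degree_in e F R b = (\<Sum>u\<in>R. degree_in e F R b)" by simp
    also have "\<dots> \<le> (\<Sum>u\<in>R. degree_in e F R u)" using mn by (intro sum_mono)
    also have "\<dots> = (\<Sum>j\<in>inside e F R. card (e j \<inter> R))"
      unfolding degree_in_def by (rule sum_incidences) (use assms fR in auto)
    also have "\<dots> = (\<Sum>j\<in>inside e F R. 3)"
      by (intro sum.cong) (auto simp: inside_def assms(5) Int_absorb2)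
    finally have "card R * degree_in e F R b \<le> 3 * card (inside e F R)" by simp
    then have *: "card R * degree_in e F R b \<le> 3 * card (inside e F R') + 3 * degree_in e F R b"
      using eq by simp
    have "card R \<le> 3 * card (inside e F R') + 3"
    proof (cases "card R \<le> 3")
      case False
      then obtain c where c: "card R = c + 3" by (metis add.commute le_Suc_ex nat_le_linear)
      have "c \<le> c * degree_in e F R b" using \<open>degree_in e F R b \<noteq> 0\<close> by simp
      moreover have "c * degree_in e F R b \<le> 3 * card (inside e F R')"
        using * c by (simp add: algebra_simps)
      ultimately show ?thesis using c by linarith
    qed simp
    then show ?thesis using cR by simp
  qed
qed

text \<open>
  A vertex of least degree among \<open>q\<close> unprotected ones lies in at most a fraction \<open>2 / q\<close> of the
  hyperedges, since each has at most two unprotected vertices. So this ratio, with \<open>q (q - 1)\<close> in the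
  denominator, never decreases while peeling.
\<close>

definition peel_ratio :: "('i \<Rightarrow> 'v set) \<Rightarrow> 'i set \<Rightarrow> 'v set \<Rightarrow> 'v set \<Rightarrow> real" where
  "peel_ratio e F H R =
     real (card (inside e F R)) / (real (card (R - H)) * (real (card (R - H)) - 1))"

section \<open>Peeling around a protected set\<close>

text \<open>Every counted hyperedge meets \<open>H\<close>, so outside \<open>H\<close> it behaves
  like an edge of a graph, and peeling loses hyperedges at a quadratic instead of a cubic
  rate.\<close>

locale protected =
  fixes e :: "'i \<Rightarrow> 'v set" and F :: "'i set" and H :: "'v set"
  assumes finF: "finite F"
    and card3: "j \<in> F \<Longrightarrow> card (e j) = 3"
    and meets: "j \<in> F \<Longrightarrow> e j \<inter> H \<noteq> {}"
begin

lemma card_edge_outside: "j \<in> F \<Longrightarrow> card (e j - H) \<le> 2"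
proof -
  assume j: "j \<in> F"
  have "finite (e j)" using card3[OF j] by (metis card.infinite zero_neq_numeral)
  moreover have "e j - H \<subset> e j" using meets[OF j] by auto
  ultimately have "card (e j - H) < card (e j)" by (rule psubset_card_mono)
  then show ?thesis using card3[OF j] by simp
qed

lemma sum_degree_outside:
  assumes "finite R"
  shows "(\<Sum>u\<in>R - H. degree_in e F R u) \<le> 2 * card (inside e F R)"
proof -
  have "(\<Sum>u\<in>R - H. degree_in e F R u) = (\<Sum>j\<in>inside e F R. card (e j \<inter> (R - H)))"
    unfolding degree_in_def by (rule sum_incidences) (use finF assms in auto)
  also have "\<dots> \<le> (\<Sum>j\<in>inside e F R. 2)"
  proof (rule sum_mono)
    fix j assume "j \<in> inside e F R"
    then have "e j \<inter> (R - H) = e j - H" "j \<in> F" by (auto simp: inside_def)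
    then show "card (e j \<inter> (R - H)) \<le> 2" using card_edge_outside by simp
  qed
  finally show ?thesis by (simp add: mult.commute)
qed

text \<open>What one step does while unprotected vertices remain, bundled for reuse. The degree
  bound is least degree against average degree.\<close>

lemma peel_step_outside:
  assumes "peel_step e F H R R'" "R - H \<noteq> {}" "finite R" "H \<subseteq> R"
  obtains b where "b \<in> R - H" "R' = R - {b}" "H \<subseteq> R'" "card (R - H) = Suc (card (R' - H))"
    "card (inside e F R) = card (inside e F R') + degree_in e F R b"
    "card (R - H) * degree_in e F R b \<le> 2 * card (inside e F R)"
    "\<And>u. u \<in> R - H \<Longrightarrow> degree_in e F R b \<le> degree_in e F R u"
proof -
  from assms(1,2) obtain b where b: "b \<in> R - H" "R' = R - {b}"
    and mn: "\<And>u. u \<in> R - H \<Longrightarrow> degree_in e F R b \<le> degree_in e F R u"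
    by (auto simp: peel_step_def)
  have "R' - H = (R - H) - {b}" using b by auto
  then have c: "card (R - H) = Suc (card (R' - H))"
    using b assms(3) by (metis card.remove finite_Diff)
  have "card (R - H) * degree_in e F R b = (\<Sum>u\<in>R - H. degree_in e F R b)" by simp
  also have "\<dots> \<le> (\<Sum>u\<in>R - H. degree_in e F R u)" using mn by (intro sum_mono)
  also have "\<dots> \<le> 2 * card (inside e F R)" using sum_degree_outside assms(3) .
  finally show ?thesis
    using that[OF b _ c _ _ mn] card_inside_remove[OF finF, of e R b] b assms(4) by blast
qed

text \<open>With \<open>q\<close> unprotected vertices left after the step, at least the fraction
  \<open>(q - 1) / (q + 1)\<close> of the hyperedges survives, which is exactly the factor by which
  the denominator shrinks from \<open>(q + 1) * q\<close> to \<open>q * (q - 1)\<close>. Having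
  \<open>q \<ge> 2\<close> keeps both denominators positive.\<close>

lemma peel_step_ratio:
  assumes "peel_step e F H R R'" "finite R" "H \<subseteq> R" "2 \<le> card (R' - H)"
  shows "peel_ratio e F H R \<le> peel_ratio e F H R'"
proof -
  have R': "R' \<subseteq> R" using assms(1) by (auto simp: peel_step_def)
  have "R' - H \<noteq> {}" using assms(4) by (metis card.empty not_numeral_le_zero)
  then have "R - H \<noteq> {}" using R' by auto
  then obtain b where q: "card (R - H) = Suc (card (R' - H))"
    and eq: "card (inside e F R) = card (inside e F R') + degree_in e F R b"
    and le: "card (R - H) * degree_in e F R b \<le> 2 * card (inside e F R)"
    using peel_step_outside[OF assms(1) _ assms(2,3)] by metis
  define q c c' d where "q = real (card (R' - H))" and "c = real (card (inside e F R))"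
    and "c' = real (card (inside e F R'))" and "d = real (degree_in e F R b)"
  have q2: "2 \<le> q" and qR: "real (card (R - H)) = q + 1" and cc: "c = c' + d"
    using assms(4) q eq by (simp_all add: q_def c_def c'_def d_def)
  have "real (card (R - H) * degree_in e F R b) \<le> real (2 * card (inside e F R))"
    using le by (rule of_nat_mono)
  then have "(q + 1) * d \<le> 2 * c" by (simp add: qR c_def d_def)
  then have "c * (q - 1) \<le> c' * (q + 1)" using cc by (simp add: algebra_simps)
  then have "c * (q * (q - 1)) \<le> c' * ((q + 1) * q)"
    using q2 mult_left_mono[of "c * (q - 1)" "c' * (q + 1)" q] by (simp add: algebra_simps)
  then have "c / ((q + 1) * q) \<le> c' / (q * (q - 1))"
    using frac_le_eq[of "(q + 1) * q" "q * (q - 1)" c c'] q2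
    by (simp add: pos_le_divide_eq pos_divide_le_eq mult.commute)
  then show ?thesis by (simp add: peel_ratio_def qR q_def c_def c'_def)
qed

text \<open>Sets only shrink, so two unprotected vertices at the end mean two at every earlier
  stage. Hence no protected vertex is ever dropped and the one-step bound applies
  throughout.\<close>

lemma peel_ratio_mono:
  assumes "peel e F H R R'" "finite R" "H \<subseteq> R" "2 \<le> card (R' - H)"
  shows "H \<subseteq> R' \<and> peel_ratio e F H R \<le> peel_ratio e F H R'"
  using assms(1,4)
proof (induction rule: rtranclp_induct)
  case base
  then show ?case using assms(3) by simp
next
  case (step S S')
  have fS: "finite S" using peel_subset[OF step.hyps(1)] assms(2) finite_subset by blast
  have S': "S' \<subseteq> S" using step.hyps(2) by (auto simp: peel_step_def)
  have "2 \<le> card (S - H)"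
    using step.prems card_mono[of "S - H" "S' - H"] S' fS by fastforce
  then have IH: "H \<subseteq> S" "peel_ratio e F H R \<le> peel_ratio e F H S" using step.IH by auto
  have "S - H \<noteq> {}" using \<open>2 \<le> card (S - H)\<close> by (metis card.empty not_numeral_le_zero)
  then have "H \<subseteq> S'"
    using peel_step_outside[OF step.hyps(2) _ fS IH(1)] by metis
  then show ?case
    using IH peel_step_ratio[OF step.hyps(2) fS IH(1) step.prems] by simp
qed

section \<open>Following a dense core through the peeling\<close>

text \<open>Average degree becomes minimum degree: charging \<open>x / (2 * k)\<close> per vertex
  costs \<open>W\<close> at most \<open>x / 2\<close>, so a best subset keeps half of the
  hyperedges. The minimum degree is what can be compared with the least degree met while
  peeling.\<close>

lemma dense_core:
  assumes "finite W" "card W \<le> k" "0 < k" "x = real (card (inside e F (W \<union> H)))"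
  obtains C where "C \<subseteq> W" "x / 2 \<le> real (card (inside e F (C \<union> H)))"
    "\<And>u. u \<in> C - H \<Longrightarrow> x / (2 * real k) \<le> real (degree_in e F (C \<union> H) u)"
proof -
  \<comment> \<open>At a maximiser of this potential, dropping \<open>u\<close> must not pay off, so \<open>u\<close> has large degree.\<close>
  define f where "f C = real (card (inside e F (C \<union> H))) - card C * (x / (2 * real k))" for C
  have x0: "0 \<le> x" using assms by simp
  obtain C where C: "C \<subseteq> W" and mx: "\<And>C'. C' \<subseteq> W \<Longrightarrow> f C' \<le> f C"
  proof -
    have fin: "finite (f ` Pow W)" "f ` Pow W \<noteq> {}" using assms(1) by auto
    then obtain C where "C \<subseteq> W" "f C = Max (f ` Pow W)"
      using Max_in[OF fin] by (metis PowD imageE)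
    then show ?thesis using that Max_ge[OF fin(1)] by (metis PowI imageI)
  qed
  have fC: "finite C" using C assms(1) finite_subset by blast
  have "card W * (x / (2 * real k)) \<le> k * (x / (2 * real k))"
    using assms(2) x0 by (intro mult_right_mono) auto
  then have "x / 2 \<le> f W" using assms(3,4) by (simp add: f_def field_simps)
  also have "\<dots> \<le> f C" using mx by simp
  also have "\<dots> \<le> real (card (inside e F (C \<union> H)))" using x0 by (simp add: f_def)
  finally have 1: "x / 2 \<le> real (card (inside e F (C \<union> H)))" .
  have 2: "x / (2 * real k) \<le> real (degree_in e F (C \<union> H) u)" if u: "u \<in> C - H" for u
  proof -
    have "(C - {u}) \<union> H = (C \<union> H) - {u}" using u by auto
    then have eq: "real (card (inside e F (C \<union> H))) =
        real (card (inside e F ((C - {u}) \<union> H))) + real (degree_in e F (C \<union> H) u)"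
      using card_inside_remove[OF finF, of e "C \<union> H" u] by simp
    have "card C = Suc (card (C - {u}))" using u fC by (metis DiffD1 card.remove)
    then have "f C = f (C - {u}) + real (degree_in e F (C \<union> H) u) - x / (2 * real k)"
      unfolding f_def using eq by (simp add: algebra_simps add_divide_distrib)
    moreover have "f (C - {u}) \<le> f C" using mx C by blast
    ultimately show ?thesis by simp
  qed
  show ?thesis using that C 1 2 by blast
qed

lemma degree_in_mono: "A \<subseteq> B \<Longrightarrow> degree_in e F A u \<le> degree_in e F B u"
  unfolding degree_in_def using finF by (intro card_mono) (auto simp: inside_def)

text \<open>
  When peeling first removes a vertex of the core \<open>C\<close>, every unprotected vertex left has at least the
  degree guaranteed in \<open>C\<close>; \<open>q\<close> is the number of unprotected vertices at that moment.
\<close>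

lemma peel_survives_or_dense:
  assumes "peel e F H R0 R" "finite R0" "H \<subseteq> R0" "2 \<le> card (R - H)" "0 < k"
    and "C \<subseteq> R0" and x: "0 < x"
    and core: "\<And>u. u \<in> C - H \<Longrightarrow> x / (2 * real k) \<le> real (degree_in e F (C \<union> H) u)"
  shows "C \<subseteq> R \<or> (\<exists>q. 2 \<le> q \<and> q \<le> card R0 \<and> real q * x \<le> 4 * real k * card F \<and>
                   x / (4 * real k * real q) \<le> peel_ratio e F H R)"
  using assms(1,4)
proof (induction rule: rtranclp_induct)
  case base
  then show ?case using assms by simp
next
  case (step S S')
  have SR0: "S \<subseteq> R0" using peel_subset[OF step.hyps(1)] .
  then have fS: "finite S" using assms(2) finite_subset by blast
  have S': "S' \<subseteq> S" using step.hyps(2) by (auto simp: peel_step_def)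
  have S2: "2 \<le> card (S - H)"
    using step.prems card_mono[of "S - H" "S' - H"] S' fS by fastforce
  have HS: "H \<subseteq> S" using peel_ratio_mono[OF step.hyps(1) assms(2,3) S2] by simp
  have mono: "peel_ratio e F H S \<le> peel_ratio e F H S'"
    by (rule peel_step_ratio[OF step.hyps(2) fS HS step.prems])
  show ?case
  proof (cases "C \<subseteq> S")
    case False
    then obtain q where "2 \<le> q" "q \<le> card R0" "real q * x \<le> 4 * real k * card F"
      "x / (4 * real k * real q) \<le> peel_ratio e F H S"
      using step.IH[OF S2] by blast
    then show ?thesis using order_trans[OF _ mono] by blast
  next
    case CS: True
    have "S - H \<noteq> {}" using S2 by (metis card.empty not_numeral_le_zero)
    then obtain b where b: "b \<in> S - H" "S' = S - {b}"
      and le: "card (S - H) * degree_in e F S b \<le> 2 * card (inside e F S)"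
      using peel_step_outside[OF step.hyps(2) _ fS HS] by metis
    show ?thesis
    proof (cases "b \<in> C")
      case False
      then show ?thesis using CS b by blast
    next
      case True
      define q where "q = card (S - H)"
      have "x / (2 * real k) \<le> real (degree_in e F (C \<union> H) b)" using core True b by simp
      also have "\<dots> \<le> real (degree_in e F S b)" using degree_in_mono CS HS by simp
      finally have "real q * (x / (2 * real k)) \<le> real (q * degree_in e F S b)"
        unfolding of_nat_mult by (intro mult_left_mono) auto
      also have "\<dots> \<le> real (2 * card (inside e F S))" using le by (intro of_nat_mono) (simp add: q_def)
      finally have dense: "real q * x \<le> 4 * real k * card (inside e F S)"
        using assms(5) by (simp add: field_simps)
      have "card (inside e F S) \<le> card F" using card_mono[OF finF inside_subset] .
      then have "4 * real k * card (inside e F S) \<le> 4 * real k * card F"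
        by (intro mult_left_mono) auto
      \<comment> \<open>This limit on \<open>q\<close> is recorded because it later produces the
        bound on \<open>x ^ 2\<close>.\<close>
      then have 1: "real q * x \<le> 4 * real k * card F" using dense by linarith
      have q2: "2 \<le> q" using S2 by (simp add: q_def)
      have 2: "q \<le> card R0" unfolding q_def using SR0 assms(2) by (intro card_mono) auto
      \<comment> \<open>The density bound gives a ratio of at least
        \<open>x / (4 * k * (q - 1))\<close>; weakening \<open>q - 1\<close> to \<open>q\<close>
        keeps the later algebra simple.\<close>
      have "x / (4 * real k * real q) \<le> x / (4 * real k * (real q - 1))"
        using x assms(5) q2 by (intro divide_left_mono mult_left_mono mult_pos_pos) auto
      also have "\<dots> = (real q * x / (4 * real k)) / (real q * (real q - 1))"
        using q2 assms(5) by (simp add: field_simps)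
      also have "\<dots> \<le> real (card (inside e F S)) / (real q * (real q - 1))"
        using q2 assms(5) dense by (intro divide_right_mono) (auto simp: field_simps)
      also have "\<dots> = peel_ratio e F H S" by (simp add: peel_ratio_def q_def)
      finally have "x / (4 * real k * real q) \<le> peel_ratio e F H S'" using mono by linarith
      then show ?thesis using 1 2 q2 by blast
    qed
  qed
qed

text \<open>The first bound is monotonicity of the ratio, whose denominator is of order
  \<open>n ^ 2\<close> at the start and \<open>k ^ 2\<close> at the end. For the others, follow the
  dense core of \<open>W\<close>. If it survives, \<open>x \<le> 2 * a\<close>. If it is first hit
  with \<open>q\<close> unprotected vertices present, the ratio at that moment carries over to
  \<open>R\<close> and gives \<open>x * k \<le> 32 * q * a\<close>; then \<open>q \<le> n\<close>
  yields the linear bound and \<open>q * x \<le> 4 * k * card F\<close> the quadratic one.\<close>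

lemma peel_protected_bounds:
  fixes k n :: nat
  assumes "peel e F H V R" "finite V" "inside e F V = F" "H \<subseteq> V" "card R = k" "3 \<le> k"
    "2 * card H \<le> k" "n = card V"
  defines "a \<equiv> real (card (inside e F R))"
  shows "real (card F) * real k ^ 2 \<le> 8 * real n ^ 2 * a"
    and "\<And>W x. \<lbrakk>W \<subseteq> V; card W \<le> k; x = real (card (inside e F (W \<union> H)))\<rbrakk> \<Longrightarrow>
           x * k \<le> 32 * real n * a \<and> x ^ 2 \<le> 128 * real (card F) * a"
proof -
  have RV: "R \<subseteq> V" using peel_subset[OF assms(1)] .
  then have fR: "finite R" and kn: "k \<le> n" using assms(2,5,8) finite_subset card_mono by auto
  have fH: "finite H" using assms(2,4) finite_subset by blast
  have "k - card H \<le> card (R - H)" using diff_card_le_card_Diff[OF fH, of R] assms(5) by simp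
  then have q: "2 \<le> card (R - H)" "k \<le> 2 * card (R - H)" using assms(6,7) by auto
  have HR: "H \<subseteq> R" and mono: "peel_ratio e F H V \<le> peel_ratio e F H R"
    using peel_ratio_mono[OF assms(1,2,4) q(1)] by auto
  define p where "p = real (card (R - H)) * (real (card (R - H)) - 1)"
  \<comment> \<open>At least \<open>k / 2\<close> and at least 2 vertices of \<open>R\<close> are
    unprotected; for a number \<open>q \<ge> 2\<close>, \<open>q - 1\<close> is at least
    \<open>q / 2\<close>.\<close>
  have "real k / 2 * (real k / 4) \<le> p"
    unfolding p_def using q assms(6) by (intro mult_mono) linarith+
  then have p8: "real k ^ 2 \<le> 8 * p" by (simp add: power2_eq_square)
  then have p0: "0 < p" using assms(6) by (smt (verit) of_nat_0_less_iff zero_less_power zero_less_numeral less_le_trans)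
  have ratio: "a = peel_ratio e F H R * p"
    using p0 unfolding peel_ratio_def a_def p_def[symmetric] by simp
  have a0: "0 \<le> a" by (simp add: a_def)
  define N where "N = real (card (V - H)) * (real (card (V - H)) - 1)"
  have VH: "2 \<le> card (V - H)" "card (V - H) \<le> n"
  proof -
    have "R - H \<subseteq> V - H" using RV by auto
    then show "2 \<le> card (V - H)" using q(1) card_mono[of "V - H" "R - H"] assms(2) by simp
    show "card (V - H) \<le> n" using assms(2,8) by (auto intro: card_mono)
  qed
  have N0: "0 < N" unfolding N_def using VH by (intro mult_pos_pos) auto
  have "N \<le> real n * real n" unfolding N_def using VH by (intro mult_mono) auto
  have "peel_ratio e F H V = real (card F) / N" by (simp add: peel_ratio_def N_def assms(3))
  then have "real (card F) / N * p \<le> a"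
    unfolding ratio using mono p0 by (intro mult_right_mono) auto
  then have "real (card F) * p \<le> N * a" using N0 by (simp add: field_simps)
  also have "\<dots> \<le> real n ^ 2 * a"
    using \<open>N \<le> real n * real n\<close> a0 by (simp add: mult_right_mono power2_eq_square)
  finally have "8 * (real (card F) * p) \<le> 8 * (real n ^ 2 * a)" by simp
  moreover have "real (card F) * real k ^ 2 \<le> real (card F) * (8 * p)"
    using p8 by (intro mult_left_mono) auto
  ultimately show "real (card F) * real k ^ 2 \<le> 8 * real n ^ 2 * a" by linarith
  fix W x assume W: "W \<subseteq> V" "card W \<le> k" and x: "x = real (card (inside e F (W \<union> H)))"
  have xF: "x \<le> card F" unfolding x using card_mono[OF finF inside_subset] by simp
  have x0: "0 \<le> x" using x by simp
  have k0: "0 < k" using assms(6) by simp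
  show "x * k \<le> 32 * real n * a \<and> x ^ 2 \<le> 128 * real (card F) * a"
  proof (cases "x = 0")
    case True
    then show ?thesis using a0 by simp
  next
    case False
    then have xpos: "0 < x" using x0 by simp
    obtain C where C: "C \<subseteq> W" "x / 2 \<le> real (card (inside e F (C \<union> H)))"
      and core: "\<And>u. u \<in> C - H \<Longrightarrow> x / (2 * real k) \<le> real (degree_in e F (C \<union> H) u)"
      using dense_core[OF _ W(2) k0 x] W(1) assms(2) finite_subset by metis
    from peel_survives_or_dense[OF assms(1,2,4) q(1) k0 _ xpos core] C(1) W(1)
    consider "C \<subseteq> R" | q where "2 \<le> q" "q \<le> n" "real q * x \<le> 4 * real k * card F"
        "x / (4 * real k * real q) \<le> peel_ratio e F H R"
      using assms(8) by blast
    then show ?thesis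
    proof cases
      case 1
      have "card (inside e F (C \<union> H)) \<le> card (inside e F R)"
        using 1 HR finF by (intro card_mono) (auto simp: inside_def)
      then have xa: "x \<le> 2 * a" using C(2) by (simp add: a_def)
      have "x * k \<le> (2 * a) * n" using xa kn x0 by (intro mult_mono) auto
      also have "\<dots> \<le> 32 * real n * a" using a0 by (simp add: mult.commute mult_left_mono)
      finally have A: "x * k \<le> 32 * real n * a" .
      have "x * x \<le> real (card F) * (2 * a)" using xa xF x0 by (intro mult_mono) auto
      also have "\<dots> \<le> 128 * real (card F) * a" using a0 by simp
      finally show ?thesis using A by (simp add: power2_eq_square)
    next
      case 2
      have "x / (4 * real k * real q) * p \<le> a"
        unfolding ratio using 2(4) p0 by (intro mult_right_mono) auto
      then have "x * p \<le> 4 * k * real q * a" using 2(1) k0 by (simp add: field_simps)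
      moreover have "x * real k ^ 2 \<le> x * (8 * p)" using p8 x0 by (intro mult_left_mono) auto
      ultimately have "k * (x * k) \<le> k * (32 * real q * a)"
        by (simp add: power2_eq_square algebra_simps)
      then have *: "x * k \<le> 32 * real q * a" using k0 by simp
      also have "\<dots> \<le> 32 * real n * a" using 2(2) a0 by (intro mult_right_mono) auto
      finally have A: "x * k \<le> 32 * real n * a" .
      have "x * (x * k) \<le> x * (32 * real q * a)" using * x0 by (intro mult_left_mono)
      also have "\<dots> = 32 * a * (real q * x)" by simp
      also have "\<dots> \<le> 32 * a * (4 * real k * card F)" using 2(3) a0 by (intro mult_left_mono) auto
      finally have "k * (x ^ 2) \<le> k * (128 * real (card F) * a)"
        by (simp add: power2_eq_square algebra_simps)
      then show ?thesis using A k0 by simp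
    qed
  qed
qed

end

section \<open>Combining the three kinds of peeling\<close>

text \<open>All that the analysis needs to know about the program is that no candidate holds more
  than \<open>a\<close> hyperedges. Candidates are scored by all hyperedges \<open>I\<close>, even
  when only those meeting \<open>H\<close> guide the peeling; \<open>le_a\<close> mediates.\<close>

lemma best_peel_bound:
  fixes e :: "'i \<Rightarrow> 'v set" and k n a :: nat
  assumes I: "finite I" "inj_on e I" "\<And>j. j \<in> I \<Longrightarrow> card (e j) = 3" "\<And>j. j \<in> I \<Longrightarrow> e j \<subseteq> V"
    and V: "finite V" "card V = n"
    and W: "W \<subseteq> V" "card W = k" and k: "3 \<le> k"
    and R1: "peel e I {} V R1" "card R1 = k" "card (inside e I R1) \<le> a"
    and H: "H \<subseteq> V" "card H = k div 2"
    and heavy: "\<And>u w. u \<in> V - H \<Longrightarrow> w \<in> H \<Longrightarrow> degree_in e I V u \<le> degree_in e I V w"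
    and R2: "peel e {j \<in> I. e j \<inter> H \<noteq> {}} H V R2" "card R2 = k" "card (inside e I R2) \<le> a"
    and R3: "\<And>v. v \<in> V \<Longrightarrow> \<exists>R. peel e {j \<in> I. e j \<inter> {v} \<noteq> {}} {v} V R \<and> card R = k \<and>
               card (inside e I R) \<le> a"
  shows "real (card (inside e I W)) ^ 5 \<le> 9 * 2 ^ 24 * real n ^ 4 * real a ^ 5"
proof -
  define x where "x = real (card (inside e I W))"
  have fW: "finite W" using W(1) V(1) finite_subset by blast
  have kn: "k \<le> n" using card_mono[OF V(1) W(1)] V(2) W(2) by simp
  have IV: "inside e F V = F" if "F \<subseteq> I" for F using I(4) that by (auto simp: inside_def)
  have le_a: "card (inside e F R) \<le> a" if "card (inside e I R) \<le> a" "F \<subseteq> I" for F R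
  proof -
    have "inside e F R \<subseteq> inside e I R" using that(2) by (auto simp: inside_def)
    then show ?thesis using that(1) card_mono[OF finite_inside[OF I(1)]] le_trans by blast
  qed
  \<comment> \<open>Different indices are different triples, so a \<open>k\<close>-set contains at
    most \<open>k choose 3\<close> of them.\<close>
  have x3: "x \<le> real k ^ 3"
  proof -
    have "e ` inside e I W \<subseteq> {A. A \<subseteq> W \<and> card A = 3}" using I(3) by (auto simp: inside_def)
    then have "card (e ` inside e I W) \<le> card {A. A \<subseteq> W \<and> card A = 3}"
      by (rule card_mono[rotated]) (use fW in auto)
    moreover have "card (e ` inside e I W) = card (inside e I W)"
      using I(2) by (intro card_image inj_on_subset[OF I(2)] inside_subset)
    moreover have "card {A. A \<subseteq> W \<and> card A = 3} = k choose 3"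
      using n_subsets[OF fW] W(2) by simp
    moreover have "k choose 3 \<le> k ^ 3" using k by (intro binomial_le_pow) simp
    ultimately have "card (inside e I W) \<le> k ^ 3" by simp
    then show ?thesis unfolding x_def by (metis of_nat_le_iff of_nat_power)
  qed
  define F where "F = {j \<in> I. e j \<inter> H \<noteq> {}}"
  interpret H: protected e F H
    using I by unfold_locales (auto simp: F_def)
  have FI: "F \<subseteq> I" by (auto simp: F_def)
  have Hk: "2 * card H \<le> k" using H(2) by simp
  have fH: "finite H" using H(1) V(1) finite_subset by blast
  note b2 = H.peel_protected_bounds[OF R2(1)[folded F_def] V(1) IV[OF FI] H(1) R2(2) k Hk V(2)[symmetric]]
  have a2: "real (card (inside e F R2)) \<le> a" using le_a[OF R2(3) FI] by simp
  \<comment> \<open>Both cases give the same constant: \<open>64 ^ 2\<close> in the first,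
    \<open>512 * 72 / 9\<close> in the second.\<close>
  have main: "x ^ 2 * k \<le> 4096 * real n ^ 2 * real a ^ 2"
  proof (cases "x \<le> 2 * real (card (inside e F W))")
    case True
    have "card (inside e F W) \<le> card (inside e F (W \<union> H))"
      using H.finF by (intro card_mono) (auto simp: inside_def)
    then have "x \<le> 2 * real (card (inside e F (W \<union> H)))" using True by linarith
    then have "x * k \<le> 2 * (real (card (inside e F (W \<union> H))) * k)"
      by (metis mult.assoc mult_right_mono of_nat_0_le_iff)
    also have "\<dots> \<le> 2 * (32 * real n * real (card (inside e F R2)))"
      using conjunct1[OF b2(2)[OF W(1) _ refl]] W(2) by (intro mult_left_mono) auto
    also have "\<dots> \<le> 64 * real n * a"
      using a2 by (simp add: mult_left_mono)
    finally have "(x * k) ^ 2 \<le> (64 * real n * a) ^ 2" by (intro power_mono) (auto simp: x_def)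
    \<comment> \<open>A factor \<open>k\<close> is given away here, to match the bound of the other
      case.\<close>
    moreover have "x ^ 2 * k \<le> (x * k) ^ 2"
      using k by (simp add: power_mult_distrib mult_left_mono self_le_power)
    ultimately show ?thesis by (simp add: power_mult_distrib)
  next
    case False
    \<comment> \<open>The optimal hyperedges that avoid \<open>H\<close>; in this case they are more
      than half of all optimal ones.\<close>
    define J where "J = inside e I W - F"
    have "inside e F W = inside e I W \<inter> F" by (auto simp: inside_def F_def)
    then have "card (inside e I W) = card (inside e F W) + card J"
      unfolding J_def using card_Int_Diff[OF finite_inside[OF I(1)]] by metis
    then have Jx: "x < 2 * real (card J)" using False by (simp add: x_def)
    have fJ: "finite J" using I(1) by (simp add: J_def)
    have "(\<Sum>v\<in>W - H. card {j \<in> J. v \<in> e j}) = (\<Sum>j\<in>J. card (e j \<inter> (W - H)))"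
      by (rule sum_incidences) (use fJ fW in auto)
    also have "\<dots> = (\<Sum>j\<in>J. 3)"
    proof (rule sum.cong[OF refl])
      fix j assume "j \<in> J"
      then have "e j \<inter> (W - H) = e j" "j \<in> I" by (auto simp: J_def F_def inside_def)
      then show "card (e j \<inter> (W - H)) = 3" using I(3) by simp
    qed
    finally have sumJ: "(\<Sum>v\<in>W - H. card {j \<in> J. v \<in> e j}) = 3 * card J" by simp
    \<comment> \<open>Averaging: each hyperedge of \<open>J\<close> has all three vertices in
      \<open>W - H\<close>, a set of at most \<open>k\<close> vertices.\<close>
    have "\<exists>v\<in>W - H. 3 * card J \<le> k * card {j \<in> J. v \<in> e j}"
    proof (rule ccontr)
      assume "\<not> ?thesis"
      then have lt: "k * card {j \<in> J. v \<in> e j} < 3 * card J" if "v \<in> W - H" for v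
        using that not_le by blast
      have "0 < card J" using Jx by (cases "card J = 0") (auto simp: x_def)
      then have "W - H \<noteq> {}" using sumJ by (cases "W - H = {}") auto
      then have "(\<Sum>v\<in>W - H. k * card {j \<in> J. v \<in> e j}) < (\<Sum>v\<in>W - H. 3 * card J)"
        using lt fW by (intro sum_strict_mono) auto
      moreover have "card (W - H) \<le> k" using W(2) fW by (metis card_mono Diff_subset)
      ultimately have "k * (3 * card J) < k * (3 * card J)"
        using sumJ by (simp add: sum_distrib_left[symmetric])
      then show False by simp
    qed
    then obtain v where v: "v \<in> W - H" "3 * card J \<le> k * card {j \<in> J. v \<in> e j}" by blast
    define Fv where "Fv = {j \<in> I. e j \<inter> {v} \<noteq> {}}"
    interpret v: protected e Fv "{v}"
      using I by unfold_locales (auto simp: Fv_def)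
    have FvI: "Fv \<subseteq> I" by (auto simp: Fv_def)
    have vV: "{v} \<subseteq> V" using v W by auto
    obtain R where R: "peel e Fv {v} V R" "card R = k" "card (inside e I R) \<le> a"
      using R3 vV unfolding Fv_def by auto
    define y d where "y = real (card (inside e Fv (W \<union> {v})))" and "d = card Fv"
    have "y ^ 2 \<le> 128 * real d * real (card (inside e Fv R))"
      using v.peel_protected_bounds(2)[OF R(1) V(1) IV[OF FvI] vV R(2) k _ V(2)[symmetric] W(1) _ y_def]
        k W(2) by (simp add: d_def)
    also have "\<dots> \<le> 128 * real d * a"
      using le_a[OF R(3) FvI] by (intro mult_left_mono) auto
    finally have yb: "y ^ 2 \<le> 128 * real d * a" .
    have "card {j \<in> J. v \<in> e j} \<le> card (inside e Fv (W \<union> {v}))"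
      using v.finF by (intro card_mono finite_inside) (auto simp: J_def inside_def Fv_def)
    then have "k * card {j \<in> J. v \<in> e j} \<le> k * card (inside e Fv (W \<union> {v}))"
      by (rule mult_le_mono2)
    then have "real (3 * card J) \<le> real (k * card (inside e Fv (W \<union> {v})))"
      using v(2) by (intro of_nat_mono) linarith
    \<comment> \<open>Since \<open>card J\<close> exceeds \<open>x / 2\<close>, the vertex
      \<open>v\<close> has at least \<open>3 * x / (2 * k)\<close> optimal hyperedges.\<close>
    then have xy: "3 * x \<le> 2 * k * y" using Jx by (simp add: y_def)
    have "degree_in e I V v = d"
      unfolding degree_in_def d_def Fv_def IV[OF order_refl] by (rule arg_cong[where f = card]) auto
    then have dw: "d \<le> degree_in e I V w" if "w \<in> H" for w
      using heavy[of v w] that v(1) W(1) by auto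
    \<comment> \<open>Heavy vertices have degree at least \<open>d\<close>, and a hyperedge is
      counted at most three times in the sum of their degrees, so many hyperedges meet
      \<open>H\<close>.\<close>
    have "card H * d \<le> (\<Sum>w\<in>H. degree_in e I V w)"
      using sum_mono[of H "\<lambda>_. d" "degree_in e I V"] dw by simp
    also have "\<dots> = (\<Sum>w\<in>H. card {j \<in> F. w \<in> e j})"
      unfolding degree_in_def IV[OF order_refl]
      by (intro sum.cong refl arg_cong[where f = card]) (auto simp: F_def)
    also have "\<dots> = (\<Sum>j\<in>F. card (e j \<inter> H))"
      by (rule sum_incidences[OF H.finF fH])
    also have "\<dots> \<le> (\<Sum>j\<in>F. 3)"
    proof (rule sum_mono)
      fix j assume "j \<in> F"
      then have c: "card (e j) = 3" using H.card3 by simp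
      then have "finite (e j)" by (metis card.infinite zero_neq_numeral)
      then show "card (e j \<inter> H) \<le> 3" using card_mono[of "e j" "e j \<inter> H"] c by simp
    qed
    finally have "card H * d \<le> 3 * card F" by simp
    \<comment> \<open>Rounding in \<open>k div 2\<close> is paid for by
      \<open>k \<le> 3 * (k div 2)\<close>, an equality for \<open>k = 3\<close>.\<close>
    moreover have "k * d \<le> 3 * card H * d" using H(2) k by (intro mult_le_mono1) auto
    ultimately have "k * d \<le> 9 * card F" by linarith
    then have "real (k * d) \<le> real (9 * card F)" by (rule of_nat_mono)
    then have kd: "k * real d \<le> 9 * card F" by simp
    have "k * real d * real k ^ 2 \<le> 9 * card F * real k ^ 2"
      using kd by (intro mult_right_mono) auto
    also have "\<dots> \<le> 72 * real n ^ 2 * real (card (inside e F R2))" using b2(1) by (simp add: mult_ac)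
    also have "\<dots> \<le> 72 * real n ^ 2 * a" using a2 by (intro mult_left_mono) auto
    finally have kd3: "real d * real k ^ 3 \<le> 72 * real n ^ 2 * a"
      by (simp add: power3_eq_cube power2_eq_square mult_ac)
    have "(3 * x) ^ 2 \<le> (2 * k * y) ^ 2" using xy by (intro power_mono) (auto simp: x_def)
    then have "9 * x ^ 2 \<le> 4 * real k ^ 2 * y ^ 2" by (simp add: power_mult_distrib)
    also have "\<dots> \<le> 4 * real k ^ 2 * (128 * real d * a)" using yb by (intro mult_left_mono) auto
    \<comment> \<open>The degree \<open>d\<close> helps the heavy peeling and hurts the peeling
      around \<open>v\<close>; multiplying the two bounds eliminates it.\<close>
    finally have "9 * x ^ 2 * k \<le> 4 * real k ^ 2 * (128 * real d * a) * k"
      by (intro mult_right_mono) auto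
    also have "\<dots> = 512 * a * (real d * real k ^ 3)"
      by (simp add: power3_eq_cube power2_eq_square)
    also have "\<dots> \<le> 512 * a * (72 * real n ^ 2 * a)" using kd3 by (intro mult_left_mono) auto
    finally show ?thesis by (simp add: power2_eq_square mult_ac)
  qed
  have "card (inside e I R1) = card I \<or> k \<le> 3 * card (inside e I R1) + 2"
    using card_peel_all[OF R1(1) I(1) V(1) IV[OF order_refl] I(3)] R1(2) by blast
  then consider "card I \<le> a" | "k \<le> 3 * a + 2" using R1(3) by linarith
  then show ?thesis
  proof cases
    case 1
    have "card (inside e I W) \<le> card I" using card_mono[OF I(1) inside_subset] .
    then have "x \<le> a" using 1 by (simp add: x_def)
    then have "x ^ 5 \<le> 1 * real a ^ 5" using power_mono[of x "real a" 5] by (simp add: x_def)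
    also have "\<dots> \<le> (9 * 2 ^ 24 * real n ^ 4) * real a ^ 5"
    proof (rule mult_right_mono)
      have "1 \<le> real n ^ 4" using kn k by (intro one_le_power) simp
      then show "1 \<le> 9 * 2 ^ 24 * real n ^ 4" by simp
    qed simp
    finally show ?thesis by (simp add: x_def)
  next
    case 2
    \<comment> \<open>The value \<open>a = 0\<close> would force \<open>k \<le> 2\<close>; for
      \<open>a \<ge> 1\<close> even \<open>5 * a\<close> suffices.\<close>
    then have "k \<le> 9 * a" using k by (cases a) auto
    then have ka: "real k \<le> 9 * a" by (metis of_nat_le_iff of_nat_mult of_nat_numeral)
    \<comment> \<open>One factor \<open>x\<close> is bounded by \<open>k ^ 3\<close> and the other
      four by the square of \<open>main\<close>. Against \<open>k ^ 2\<close> a single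
      \<open>k\<close> remains, which becomes \<open>9 * a\<close>.\<close>
    have "x ^ 5 * k ^ 2 = x * (x ^ 2 * k) ^ 2"
      by (simp add: power_mult_distrib flip: power_mult power_Suc)
    also have "\<dots> \<le> real k ^ 3 * (4096 * real n ^ 2 * real a ^ 2) ^ 2"
      by (rule mult_mono[OF x3 power_mono[OF main]]) (auto simp: x_def)
    also have "\<dots> = real k * (2 ^ 24 * real n ^ 4 * real a ^ 4) * real k ^ 2"
      by (simp add: eval_nat_numeral)
    also have "\<dots> \<le> 9 * a * (2 ^ 24 * real n ^ 4 * real a ^ 4) * real k ^ 2"
      using ka by (intro mult_right_mono) auto
    also have "\<dots> = (9 * 2 ^ 24 * real n ^ 4 * real a ^ 5) * k ^ 2"
      by (simp add: eval_nat_numeral)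
    finally show ?thesis using k by (simp add: x_def)
  qed
qed

section \<open>Total correctness with cost bounds\<close>

text \<open>
  The cost when no loop, each time it is entered, makes more than \<open>N\<close> iterations.
\<close>

primrec cost_bound :: "nat \<Rightarrow> com \<Rightarrow> nat" where
  "cost_bound N Skip = 1"
| "cost_bound N (Assign x a) = 1 + acost a"
| "cost_bound N (Store x i a) = 1 + acost i + acost a"
| "cost_bound N (Seq c d) = cost_bound N c + cost_bound N d"
| "cost_bound N (If b c d) = 1 + bcost b + cost_bound N c + cost_bound N d"
| "cost_bound N (While b c) = N * (1 + bcost b + cost_bound N c) + (1 + bcost b)"

text \<open>Each loop contributes one factor \<open>N\<close>, so the degree is at most the nesting
  depth. Polynomial time thus reduces to bounding the number of iterations per loop.\<close>

lemma cost_bound_poly: "\<exists>p. \<forall>N. cost_bound N c = poly p N"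
proof (induction c)
  case (Seq c d)
  then obtain p q where "\<forall>N. cost_bound N c = poly p N" "\<forall>N. cost_bound N d = poly q N" by blast
  then show ?case by (intro exI[of _ "p + q"]) simp
next
  case (If b c d)
  then obtain p q where "\<forall>N. cost_bound N c = poly p N" "\<forall>N. cost_bound N d = poly q N" by blast
  then show ?case by (intro exI[of _ "[:1 + bcost b:] + p + q"]) simp
next
  case (While b c)
  then obtain p where "\<forall>N. cost_bound N c = poly p N" by blast
  then show ?case
    by (intro exI[of _ "[:0, 1:] * ([:1 + bcost b:] + p) + [:1 + bcost b:]"]) simp
qed (auto intro: exI[of _ "[:_:]"])

text \<open>Shaped like a weakest precondition: the starting state is fixed, so \<open>Q\<close> can
  refer to it without auxiliary variables.\<close>

definition terminates :: "nat \<Rightarrow> com \<Rightarrow> state \<Rightarrow> (state \<Rightarrow> bool) \<Rightarrow> bool" where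
  "terminates N c s Q \<longleftrightarrow> (\<exists>t s'. exec c s t s' \<and> t \<le> cost_bound N c \<and> Q s')"

lemma terminatesI: "exec c s t s' \<Longrightarrow> t \<le> cost_bound N c \<Longrightarrow> Q s' \<Longrightarrow> terminates N c s Q"
  unfolding terminates_def by blast

lemma terminatesE:
  assumes "terminates N c s Q"
  obtains t s' where "exec c s t s'" "t \<le> cost_bound N c" "Q s'"
  using assms unfolding terminates_def by blast

lemma terminates_mono: "terminates N c s P \<Longrightarrow> (\<And>s'. P s' \<Longrightarrow> Q s') \<Longrightarrow> terminates N c s Q"
  unfolding terminates_def by blast

lemma terminates_Assign:
  "Q (s\<lparr>reg := (reg s)(x := aval a s)\<rparr>) \<Longrightarrow> terminates N (Assign x a) s Q"
  by (rule terminatesI[OF exec_Assign]) auto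

lemma terminates_Store:
  "Q (s\<lparr>arr := (arr s)(x := (arr s x)(aval i s := aval a s))\<rparr>) \<Longrightarrow> terminates N (Store x i a) s Q"
  by (rule terminatesI[OF exec_Store]) auto

lemma terminates_Skip: "Q s \<Longrightarrow> terminates N Skip s Q"
  by (rule terminatesI[OF exec_Skip]) auto

lemma terminates_Seq:
  assumes "terminates N c s (\<lambda>s'. terminates N d s' Q)"
  shows "terminates N (Seq c d) s Q"
proof -
  obtain t s' where c: "exec c s t s'" "t \<le> cost_bound N c" "terminates N d s' Q"
    using assms by (rule terminatesE)
  obtain t' s'' where d: "exec d s' t' s''" "t' \<le> cost_bound N d" "Q s''"
    using c(3) by (rule terminatesE)
  show ?thesis by (rule terminatesI[OF exec_Seq[OF c(1) d(1)]]) (use c d in auto)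
qed

lemma terminates_If:
  assumes "bval b s \<Longrightarrow> terminates N c s Q" "\<not> bval b s \<Longrightarrow> terminates N d s Q"
  shows "terminates N (If b c d) s Q"
proof (cases "bval b s")
  case True
  obtain t s' where c: "exec c s t s'" "t \<le> cost_bound N c" "Q s'"
    using assms(1)[OF True] by (rule terminatesE)
  show ?thesis by (rule terminatesI[OF exec_IfTrue[OF True c(1)]]) (use c in auto)
next
  case False
  obtain t s' where d: "exec d s t s'" "t \<le> cost_bound N d" "Q s'"
    using assms(2)[OF False] by (rule terminatesE)
  show ?thesis by (rule terminatesI[OF exec_IfFalse[OF False d(1)]]) (use d in auto)
qed

text \<open>The variant both proves termination and counts iterations: it starts at no more than
  \<open>N\<close> and drops each time.\<close>

lemma terminates_While:
  fixes \<mu> :: "state \<Rightarrow> nat"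
  assumes "P s" "\<mu> s \<le> N"
    and body: "\<And>s. P s \<Longrightarrow> bval b s \<Longrightarrow> terminates N c s (\<lambda>s'. P s' \<and> \<mu> s' < \<mu> s)"
    and exit: "\<And>s. P s \<Longrightarrow> \<not> bval b s \<Longrightarrow> Q s"
  shows "terminates N (While b c) s Q"
proof -
  \<comment> \<open>The induction needs the allowance \<open>\<mu> s\<close>, which shrinks with the
    state, in place of the fixed \<open>N\<close>.\<close>
  have "\<exists>t s'. exec (While b c) s t s' \<and>
      t \<le> \<mu> s * (1 + bcost b + cost_bound N c) + (1 + bcost b) \<and> Q s'" if "P s" for s
    using that
  proof (induction "\<mu> s" arbitrary: s rule: less_induct)
    case less
    show ?case
    proof (cases "bval b s")
      case False
      then show ?thesis using exec_WhileFalse[OF False] exit[OF less.prems]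
        by (intro exI conjI) (assumption, auto)
    next
      case True
      obtain t s' where c: "exec c s t s'" "t \<le> cost_bound N c" "P s'" "\<mu> s' < \<mu> s"
        using terminatesE[OF body[OF less.prems True]] by blast
      obtain t' s'' where w: "exec (While b c) s' t' s''"
        "t' \<le> \<mu> s' * (1 + bcost b + cost_bound N c) + (1 + bcost b)" "Q s''"
        using less.hyps[OF c(4,3)] by blast
      have "Suc (\<mu> s') * (1 + bcost b + cost_bound N c) \<le> \<mu> s * (1 + bcost b + cost_bound N c)"
        using c(4) by (intro mult_le_mono1) simp
      then have "1 + bcost b + t + t' \<le> \<mu> s * (1 + bcost b + cost_bound N c) + (1 + bcost b)"
        using c(2) w(2) by simp
      then show ?thesis using exec_WhileTrue[OF True c(1) w(1)] w(3) by blast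
    qed
  qed
  from this[OF assms(1)] obtain t s' where w: "exec (While b c) s t s'" "Q s'"
    "t \<le> \<mu> s * (1 + bcost b + cost_bound N c) + (1 + bcost b)" by blast
  moreover have "\<mu> s * (1 + bcost b + cost_bound N c) \<le> N * (1 + bcost b + cost_bound N c)"
    using assms(2) by (rule mult_le_mono1)
  ultimately have "t \<le> cost_bound N (While b c)" by simp
  then show ?thesis using w by (intro terminatesI)
qed

section \<open>Frame conditions and counting loops\<close>

primrec written_regs :: "com \<Rightarrow> vname set" where
  "written_regs Skip = {}"
| "written_regs (Assign x a) = {x}"
| "written_regs (Store x i a) = {}"
| "written_regs (Seq c d) = written_regs c \<union> written_regs d"
| "written_regs (If b c d) = written_regs c \<union> written_regs d"
| "written_regs (While b c) = written_regs c"

primrec written_arrs :: "com \<Rightarrow> vname set" where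
  "written_arrs Skip = {}"
| "written_arrs (Assign x a) = {}"
| "written_arrs (Store x i a) = {x}"
| "written_arrs (Seq c d) = written_arrs c \<union> written_arrs d"
| "written_arrs (If b c d) = written_arrs c \<union> written_arrs d"
| "written_arrs (While b c) = written_arrs c"

lemma exec_reg_unchanged: "exec c s t s' \<Longrightarrow> x \<notin> written_regs c \<Longrightarrow> reg s' x = reg s x"
  by (induction rule: exec.induct) auto

lemma exec_arr_unchanged: "exec c s t s' \<Longrightarrow> x \<notin> written_arrs c \<Longrightarrow> arr s' x = arr s x"
  by (induction rule: exec.induct) auto

definition same_except :: "com \<Rightarrow> state \<Rightarrow> state \<Rightarrow> bool" where
  "same_except c s s' \<longleftrightarrow>
     (\<forall>x. x \<notin> written_regs c \<longrightarrow> reg s' x = reg s x) \<and>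
     (\<forall>x. x \<notin> written_arrs c \<longrightarrow> arr s' x = arr s x)"

text \<open>Everything that a program does not syntactically write is preserved, so specifications
  and invariants need not list it.\<close>

lemma terminates_frame:
  "terminates N c s Q \<Longrightarrow> terminates N c s (\<lambda>s'. same_except c s s' \<and> Q s')"
  unfolding terminates_def same_except_def
  using exec_reg_unchanged exec_arr_unchanged by blast

lemma same_except_reg: "same_except c s s' \<Longrightarrow> x \<notin> written_regs c \<Longrightarrow> reg s' x = reg s x"
  by (simp add: same_except_def)

lemma same_except_arr: "same_except c s s' \<Longrightarrow> x \<notin> written_arrs c \<Longrightarrow> arr s' x = arr s x"
  by (simp add: same_except_def)

lemma same_except_refl: "same_except c s s"
  by (simp add: same_except_def)

lemma terminates_While_frame:
  fixes \<mu> :: "state \<Rightarrow> nat"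
  assumes "P s" "\<mu> s \<le> N"
    and body: "\<And>s'. P s' \<Longrightarrow> bval b s' \<Longrightarrow> same_except c s s' \<Longrightarrow>
                 terminates N c s' (\<lambda>s''. P s'' \<and> \<mu> s'' < \<mu> s')"
    and exit: "\<And>s'. P s' \<Longrightarrow> \<not> bval b s' \<Longrightarrow> same_except c s s' \<Longrightarrow> Q s'"
  shows "terminates N (While b c) s Q"
proof (rule terminates_While[where P = "\<lambda>s'. P s' \<and> same_except c s s'" and \<mu> = \<mu>])
  fix s' assume *: "P s' \<and> same_except c s s'" "bval b s'"
  have "terminates N c s' (\<lambda>s''. same_except c s' s'' \<and> P s'' \<and> \<mu> s'' < \<mu> s')"
    by (rule terminates_frame, rule body) (use * in auto)
  then show "terminates N c s' (\<lambda>s''. (P s'' \<and> same_except c s s'') \<and> \<mu> s'' < \<mu> s')"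
    by (rule terminates_mono) (use * in \<open>auto simp: same_except_def\<close>)
qed (use assms same_except_refl in auto)

definition for_loop :: "vname \<Rightarrow> vname \<Rightarrow> com \<Rightarrow> com" where
  "for_loop x y c = Seq (Assign x (Num 0))
     (While (Less (Var x) (Var y)) (Seq c (Assign x (Plus (Var x) (Num 1)))))"

lemma written_for_loop [simp]:
  "written_regs (for_loop x y c) = insert x (written_regs c)"
  "written_arrs (for_loop x y c) = written_arrs c"
  by (auto simp: for_loop_def)

text \<open>The postcondition of the body speaks of the state with the counter already advanced, so
  \<open>P i\<close> always describes the state at the loop test. The bound \<open>reg s y\<close>
  is that on entry, since the body writes neither \<open>x\<close> nor \<open>y\<close>.\<close>

lemma terminates_for_loop:
  assumes "reg s y \<le> N" "x \<noteq> y" "x \<notin> written_regs c" "y \<notin> written_regs c"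
    and init: "P 0 (s\<lparr>reg := (reg s)(x := 0)\<rparr>)"
    and body: "\<And>i s'. i < reg s y \<Longrightarrow> P i s' \<Longrightarrow> reg s' x = i \<Longrightarrow> same_except (for_loop x y c) s s' \<Longrightarrow>
      terminates N c s' (\<lambda>s''. P (Suc i) (s''\<lparr>reg := (reg s'')(x := Suc i)\<rparr>))"
    and exit: "\<And>s'. P (reg s y) s' \<Longrightarrow> same_except (for_loop x y c) s s' \<Longrightarrow> Q s'"
  shows "terminates N (for_loop x y c) s Q"
proof -
  let ?inc = "Assign x (Plus (Var x) (Num 1))"
  show ?thesis
    unfolding for_loop_def
  proof (rule terminates_Seq, rule terminates_Assign,
      rule terminates_While_frame[where P = "\<lambda>s'. reg s' x \<le> reg s y \<and> P (reg s' x) s'"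
        and \<mu> = "\<lambda>s'. reg s y - reg s' x"], goal_cases)
    case 1
    then show ?case using init by simp
  next
    case 2
    then show ?case using assms(1) by simp
  next
    case (3 s')
    have same: "same_except (for_loop x y c) s s'"
      using 3(3) by (auto simp: same_except_def)
    have y: "reg s' y = reg s y" using same_except_reg[OF same] assms(2,4) by simp
    then have lt: "reg s' x < reg s y" using 3(2) by simp
    have "terminates N c s' (\<lambda>s''. same_except c s' s'' \<and>
        P (Suc (reg s' x)) (s''\<lparr>reg := (reg s'')(x := Suc (reg s' x))\<rparr>))"
      by (rule terminates_frame, rule body) (use 3 lt same in auto)
    then show ?case
    proof (intro terminates_Seq, rule terminates_mono)
      fix s''
      assume *: "same_except c s' s'' \<and>
        P (Suc (reg s' x)) (s''\<lparr>reg := (reg s'')(x := Suc (reg s' x))\<rparr>)"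
      then have "reg s'' x = reg s' x" using same_except_reg assms(3) by blast
      then show "terminates N ?inc s'' (\<lambda>s''. (reg s'' x \<le> reg s y \<and> P (reg s'' x) s'') \<and>
          reg s y - reg s'' x < reg s y - reg s' x)"
        using * lt by (intro terminates_Assign) simp
    qed
  next
    case (4 s')
    have same: "same_except (for_loop x y c) s s'"
      using 4(3) by (auto simp: same_except_def)
    have y: "reg s' y = reg s y" using same_except_reg[OF same] assms(2,4) by simp
    then have "reg s' x = reg s y" using 4(1,2) by simp
    then show ?case using exit 4(1) same by simp
  qed
qed

section \<open>The program\<close>

abbreviation nonzero :: "aexp \<Rightarrow> bexp" where
  "nonzero a \<equiv> Not (Eq a (Num 0))"

text \<open>The expression may mention the counter \<open>''i''\<close>, so this also copies
  arrays.\<close>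

definition fill :: "vname \<Rightarrow> aexp \<Rightarrow> com" where
  "fill x a = for_loop ''i'' ''n'' (Store x (Var ''i'') a)"

text \<open>The index \<open>3 * j\<close> is a repeated sum, as the language has no
  multiplication.\<close>

definition load_edge :: com where
  "load_edge = (let l = Plus (Var ''j'') (Plus (Var ''j'') (Var ''j'')) in
     Seq (Assign ''a'' (Cell ''E'' l))
    (Seq (Assign ''b'' (Cell ''E'' (Plus l (Num 1))))
         (Assign ''c'' (Cell ''E'' (Plus l (Num 2))))))"

definition edge_inside :: bexp where
  "edge_inside = And (nonzero (Cell ''R'' (Var ''a'')))
     (And (nonzero (Cell ''R'' (Var ''b''))) (nonzero (Cell ''R'' (Var ''c''))))"

text \<open>
  If register \<open>g\<close> is nonzero, all hyperedges count, else only those meeting the set in array \<open>H\<close>.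
\<close>

definition edge_active :: bexp where
  "edge_active = nonzero (Plus (Var ''g'') (Plus (Cell ''H'' (Var ''a''))
     (Plus (Cell ''H'' (Var ''b'')) (Cell ''H'' (Var ''c'')))))"

definition increment :: "vname \<Rightarrow> com" where
  "increment x = Store ''D'' (Var x) (Plus (Cell ''D'' (Var x)) (Num 1))"

text \<open>
  Protected vertices start with a penalty above every possible degree, so they are dropped last.
\<close>

definition count_degrees :: com where
  "count_degrees =
     Seq (for_loop ''i'' ''n'' (If (Eq (Cell ''H'' (Var ''i'')) (Num 0))
            (Store ''D'' (Var ''i'') (Num 0))
            (Store ''D'' (Var ''i'') (Plus (Var ''m'') (Num 1)))))
    (for_loop ''j'' ''m'' (Seq load_edge (If (And edge_active edge_inside)
            (Seq (increment ''a'') (Seq (increment ''b'') (increment ''c''))) Skip)))"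

text \<open>The starting value \<open>2 * m + 2\<close> of \<open>''l''\<close> exceeds every
  possible entry of \<open>''D''\<close>, a penalty \<open>m + 1\<close> plus a degree, so some
  remaining vertex is always chosen.\<close>

definition drop_min :: com where
  "drop_min =
     Seq (Assign ''l'' (Plus (Var ''m'') (Plus (Var ''m'') (Num 2))))
    (Seq (for_loop ''i'' ''n''
       (If (And (nonzero (Cell ''R'' (Var ''i''))) (Less (Cell ''D'' (Var ''i'')) (Var ''l'')))
           (Seq (Assign ''l'' (Cell ''D'' (Var ''i''))) (Assign ''v'' (Var ''i''))) Skip))
    (Seq (Store ''R'' (Var ''v'') (Num 0))
         (Assign ''r'' (Minus (Var ''r'') (Num 1)))))"

definition peel_all :: com where
  "peel_all = Seq (fill ''R'' (Num 1)) (Seq (Assign ''r'' (Var ''n''))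
     (While (Less (Var ''k'') (Var ''r'')) (Seq count_degrees drop_min)))"

text \<open>
  Register \<open>o\<close> is one more than the number of hyperedges inside the best set so far. It is initially 0,
  so that the first candidate is recorded even if it contains no hyperedge.
\<close>

definition offer :: com where
  "offer = Seq (Assign ''q'' (Num 1))
    (Seq (for_loop ''j'' ''m'' (Seq load_edge
        (If edge_inside (Assign ''q'' (Plus (Var ''q'') (Num 1))) Skip)))
    (If (Less (Var ''o'') (Var ''q''))
        (Seq (Assign ''o'' (Var ''q'')) (fill ''W'' (Cell ''R'' (Var ''i'')))) Skip))"

text \<open>Degrees are counted once and stay frozen while the lightest vertices are dropped; the
  test \<open>k < r + r\<close> replaces division by 2. Clearing \<open>''g''\<close> makes later
  rounds count only hyperedges meeting \<open>''H''\<close>.\<close>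

definition select_heavy :: com where
  "select_heavy = Seq (fill ''R'' (Num 1)) (Seq (Assign ''r'' (Var ''n'')) (Seq count_degrees
     (Seq (While (Less (Var ''k'') (Plus (Var ''r'') (Var ''r''))) drop_min)
     (Seq (fill ''H'' (Cell ''R'' (Var ''i''))) (Assign ''g'' (Num 0))))))"

definition peel_round :: com where
  "peel_round = Seq peel_all offer"

text \<open>The first round and \<open>select_heavy\<close> rely on array \<open>''H''\<close> being
  zero in the initial state.\<close>

definition densest_alg :: com where
  "densest_alg = Seq (Assign ''g'' (Num 1)) (Seq peel_round (Seq select_heavy (Seq peel_round
     (for_loop ''x'' ''n'' (Seq (fill ''H'' (Num 0)) (Seq (Store ''H'' (Var ''x'') (Num 1))
        peel_round))))))"

lemmas com_defs = fill_def load_edge_def increment_def count_degrees_def drop_min_def peel_all_def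
  offer_def select_heavy_def peel_round_def

lemma written [simp]:
  "written_regs (fill x a) = {''i''}"
  "written_arrs (fill x a) = {x}"
  "written_regs load_edge = {''a'', ''b'', ''c''}"
  "written_arrs load_edge = {}"
  "written_regs (increment x) = {}"
  "written_arrs (increment x) = {''D''}"
  "written_regs count_degrees = {''i'', ''j'', ''a'', ''b'', ''c''}"
  "written_arrs count_degrees = {''D''}"
  "written_regs drop_min = {''l'', ''i'', ''v'', ''r''}"
  "written_arrs drop_min = {''R''}"
  "written_regs peel_all = {''i'', ''r'', ''j'', ''a'', ''b'', ''c'', ''l'', ''v''}"
  "written_arrs peel_all = {''R'', ''D''}"
  "written_regs offer = {''q'', ''j'', ''a'', ''b'', ''c'', ''o'', ''i''}"
  "written_arrs offer = {''W''}"
  "written_regs select_heavy = {''i'', ''r'', ''j'', ''a'', ''b'', ''c'', ''l'', ''v'', ''g''}"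
  "written_arrs select_heavy = {''R'', ''D'', ''H''}"
  "written_regs peel_round = {''i'', ''r'', ''j'', ''a'', ''b'', ''c'', ''l'', ''v'', ''q'', ''o''}"
  "written_arrs peel_round = {''R'', ''D'', ''W''}"
  by (auto simp: com_defs Let_def)

section \<open>Verification\<close>

definition triple_set :: "nat \<times> nat \<times> nat \<Rightarrow> nat set" where
  "triple_set = (\<lambda>(a, b, c). {a, b, c})"

lemma card_less_Suc_Collect:
  "card {l. l < Suc j \<and> P l} = card {l. l < j \<and> P l} + (if P j then 1 else 0)"
proof -
  have "{l. l < Suc j \<and> P l} = (if P j then insert j {l. l < j \<and> P l} else {l. l < j \<and> P l})"
    by (auto simp: less_Suc_eq)
  then show ?thesis by simp
qed

locale run =
  fixes n k N :: nat and es :: "(nat \<times> nat \<times> nat) list"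
  assumes triple_in: "t \<in> set es \<Longrightarrow> triple_set t \<subseteq> {..<n}"
    and triple_card: "t \<in> set es \<Longrightarrow> card (triple_set t) = 3"
    and size: "n + length es \<le> N"
    and k_le_n: "k \<le> n"
begin

abbreviation m :: nat where "m \<equiv> length es"

abbreviation tri :: "nat \<Rightarrow> nat set" where "tri j \<equiv> triple_set (es ! j)"

text \<open>The part of the initial state that no piece of the program overwrites.\<close>

definition input :: "state \<Rightarrow> bool" where
  "input s \<longleftrightarrow> reg s ''n'' = n \<and> reg s ''m'' = m \<and> reg s ''k'' = k \<and>
     (\<forall>j<m. es ! j = (arr s ''E'' (j + (j + j)), arr s ''E'' (j + (j + j) + 1),
                        arr s ''E'' (j + (j + j) + 2)))"

lemma input_same:
  "same_except c s s' \<Longrightarrow> {''n'', ''m'', ''k''} \<inter> written_regs c = {} \<Longrightarrow> ''E'' \<notin> written_arrs c \<Longrightarrow>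
   input s' = input s"
  by (auto simp: input_def same_except_def)

definition supp :: "state \<Rightarrow> vname \<Rightarrow> nat set" where
  "supp s x = {i. i < n \<and> arr s x i \<noteq> 0}"

definition active :: "state \<Rightarrow> nat set" where
  "active s = {j. j < m \<and> (reg s ''g'' \<noteq> 0 \<or> tri j \<inter> supp s ''H'' \<noteq> {})}"

text \<open>The value that \<open>count_degrees\<close> leaves in \<open>''D''\<close>; the summand
  \<open>Suc m\<close> is the penalty of a protected vertex.\<close>

definition key :: "state \<Rightarrow> nat \<Rightarrow> nat" where
  "key s i = (if arr s ''H'' i = 0 then 0 else Suc m) + degree_in tri (active s) (supp s ''R'') i"

lemma supp_simps: "finite (supp s x)" "supp s x \<subseteq> {..<n}"
  by (auto simp: supp_def)

lemma terminates_fill: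
  assumes "input s" "x \<noteq> ''i''"
    "\<And>i s'. same_except (fill x a) s s' \<Longrightarrow> i < n \<Longrightarrow> reg s' ''i'' = i \<Longrightarrow> aval a s' = f i"
  shows "terminates N (fill x a) s (\<lambda>s'. same_except (fill x a) s s' \<and> (\<forall>i<n. arr s' x i = f i))"
  unfolding fill_def
proof (rule terminates_for_loop[where P = "\<lambda>i s'. \<forall>j<i. arr s' x j = f j"], goal_cases)
  case (6 i s')
  then have "aval a s' = f i" using assms(1,3) by (auto simp: fill_def input_def)
  then show ?case using 6 by (intro terminates_Store) (auto simp: less_Suc_eq)
qed (use assms(1) size in \<open>auto simp: input_def\<close>)

text \<open>The positions are distinct because the triple has three elements;
  \<open>count_degrees\<close> needs this so that its three increments hit different cells.\<close>

lemma terminates_load_edge: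
  assumes "input s" "reg s ''j'' = j" "j < m"
    "\<And>a b c. es ! j = (a, b, c) \<Longrightarrow> a < n \<Longrightarrow> b < n \<Longrightarrow> c < n \<Longrightarrow> a \<noteq> b \<Longrightarrow> a \<noteq> c \<Longrightarrow> b \<noteq> c \<Longrightarrow>
       tri j = {a, b, c} \<Longrightarrow>
       Q (s\<lparr>reg := (reg s)(''a'' := a, ''b'' := b, ''c'' := c)\<rparr>)"
  shows "terminates N load_edge s Q"
proof -
  obtain a b c where e: "es ! j = (a, b, c)" by (cases "es ! j")
  have t: "tri j = {a, b, c}" by (simp add: e triple_set_def)
  have mem: "es ! j \<in> set es" using assms(3) by simp
  have "a < n" "b < n" "c < n" using triple_in[OF mem] t by auto
  moreover have "a \<noteq> b" "a \<noteq> c" "b \<noteq> c"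
    using triple_card[OF mem] t by (auto simp: card_insert_if split: if_splits)
  ultimately have Q: "Q (s\<lparr>reg := (reg s)(''a'' := a, ''b'' := b, ''c'' := c)\<rparr>)"
    using assms(4) e t by blast
  have "arr s ''E'' (j + (j + j)) = a" "arr s ''E'' (Suc (j + (j + j))) = b"
    "arr s ''E'' (Suc (Suc (j + (j + j)))) = c"
    using assms(1,3) e by (auto simp: input_def)
  then show ?thesis
    unfolding load_edge_def Let_def
    by (intro terminates_Seq terminates_Assign) (use Q assms(2) in simp)
qed

lemma mem_inside: "j < m \<Longrightarrow> tri j = {a, b, c} \<Longrightarrow> a < n \<Longrightarrow> b < n \<Longrightarrow> c < n \<Longrightarrow> F \<subseteq> {..<m} \<Longrightarrow>
  j \<in> inside tri F (supp s x) \<longleftrightarrow> j \<in> F \<and> arr s x a \<noteq> 0 \<and> arr s x b \<noteq> 0 \<and> arr s x c \<noteq> 0"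
  by (auto simp: inside_def supp_def)

lemma terminates_count_degrees:
  assumes "input s"
  shows "terminates N count_degrees s
    (\<lambda>s'. same_except count_degrees s s' \<and> (\<forall>i<n. arr s' ''D'' i = key s i))"
proof -
  let ?J = "inside tri (active s) (supp s ''R'')"
  let ?c = "\<lambda>i. if arr s ''H'' i = 0 then 0 else Suc m"
  have J: "{l. l < m \<and> l \<in> ?J \<and> i \<in> tri l} = {l \<in> ?J. i \<in> tri l}" for i
    by (auto simp: inside_def active_def)
  have "terminates N count_degrees s (\<lambda>s'. \<forall>i<n. arr s' ''D'' i = key s i)"
    unfolding count_degrees_def
  proof (intro terminates_Seq terminates_for_loop[where x = "''i''" and P = "\<lambda>i s'. \<forall>l<i. arr s' ''D'' l = ?c l"],
      goal_cases)
    case (6 i s')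
    note r = same_except_reg[OF 6(4)] and a = same_except_arr[OF 6(4)]
    have "reg s' ''m'' = m" "arr s' ''H'' = arr s ''H''"
      using assms r a by (simp_all add: input_def)
    then show ?case using 6 by (intro terminates_If terminates_Store) (auto simp: less_Suc_eq)
  next
    case (7 s1)
    note r1 = same_except_reg[OF 7(2)] and a1 = same_except_arr[OF 7(2)]
    have n: "reg s ''n'' = n" and m1: "reg s1 ''m'' = m" and in1: "input s1"
      using assms r1 input_same[OF 7(2)] by (simp_all add: input_def)
    show ?case
    \<comment> \<open>The invariant is the penalty plus the degree restricted to the first
      \<open>j\<close> hyperedges, always relative to the sets in the starting state
      \<open>s\<close>.\<close>
    proof (rule terminates_for_loop[where P = "\<lambda>j s'. \<forall>i<n. arr s' ''D'' i =
          ?c i + card {l. l < j \<and> l \<in> ?J \<and> i \<in> tri l}"], goal_cases)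
      case 1
      then show ?case using m1 size by simp
    next
      case 5
      then show ?case using \<open>\<forall>l<reg s ''n''. _ l\<close> n by simp
    next
      case (6 j s')
      note r = same_except_reg[OF 6(4)] and a = same_except_arr[OF 6(4)]
      have ins: "input s'" using in1 input_same[OF 6(4)] by simp
      have H: "arr s' ''H'' = arr s ''H''" "arr s' ''R'' = arr s ''R''" "reg s' ''g'' = reg s ''g''"
        using a a1 r r1 by simp_all
      have jm: "j < m" using 6(1) m1 by simp
      show ?case
      proof (rule terminates_Seq, rule terminates_load_edge[OF ins 6(3) jm])
        fix a b c
        assume t: "es ! j = (a, b, c)" "a < n" "b < n" "c < n" "a \<noteq> b" "a \<noteq> c" "b \<noteq> c"
          "tri j = {a, b, c}"
        let ?s = "s'\<lparr>reg := (reg s')(''a'' := a, ''b'' := b, ''c'' := c)\<rparr>"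
        have "active s \<subseteq> {..<m}" by (auto simp: active_def)
        moreover have "j \<in> active s \<longleftrightarrow> reg s ''g'' \<noteq> 0 \<or> arr s ''H'' a \<noteq> 0 \<or> arr s ''H'' b \<noteq> 0 \<or> arr s ''H'' c \<noteq> 0"
          using jm t by (auto simp: active_def supp_def)
        ultimately have b: "bval (And edge_active edge_inside) ?s \<longleftrightarrow> j \<in> ?J"
          using mem_inside[OF jm t(8,2-4)] H by (auto simp: edge_active_def edge_inside_def)
        show "terminates N (If (And edge_active edge_inside)
            (Seq (increment ''a'') (Seq (increment ''b'') (increment ''c''))) Skip) ?s
            (\<lambda>s''. \<forall>i<n. arr (s''\<lparr>reg := (reg s'')(''j'' := Suc j)\<rparr>) ''D'' i =
               ?c i + card {l. l < Suc j \<and> l \<in> ?J \<and> i \<in> tri l})"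
          unfolding increment_def card_less_Suc_Collect
          by (intro terminates_If terminates_Seq terminates_Store terminates_Skip; unfold b)
            (use 6(2) t in auto)
      qed
    next
      case (7 s')
      then show ?case using m1 by (simp add: J key_def degree_in_def)
    qed simp_all
  qed (use assms size in \<open>auto simp: input_def\<close>)
  then show ?thesis by (rule terminates_frame)
qed

lemma degree_le_m: "degree_in tri (active s) R i \<le> m"
proof -
  have "degree_in tri (active s) R i \<le> card {..<m}"
    unfolding degree_in_def by (rule card_mono) (auto simp: inside_def active_def)
  then show ?thesis by simp
qed

lemma key_less: "key s i < m + (m + 2)"
  using degree_le_m[of s "supp s ''R''" i] by (simp add: key_def)

text \<open>If an unprotected vertex remains, its key is at most \<open>m\<close>, so a vertex of
  least key carries no penalty, and among unprotected vertices keys are degrees. If none remains,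
  \<open>peel_step\<close> allows any choice.\<close>

lemma key_minimal_step:
  assumes "b \<in> supp s ''R''" "\<And>u. u \<in> supp s ''R'' \<Longrightarrow> key s b \<le> key s u"
  shows "peel_step tri (active s) (supp s ''H'') (supp s ''R'') (supp s ''R'' - {b})"
  unfolding peel_step_def
proof (intro bexI[of _ b] conjI impI ballI)
  note deg = degree_le_m[of s]
  assume "supp s ''R'' - supp s ''H'' \<noteq> {}"
  then obtain u where u: "u \<in> supp s ''R''" "arr s ''H'' u = 0" by (auto simp: supp_def)
  have "key s b \<le> m" using assms(2)[OF u(1)] u(2) deg[of "supp s ''R''" u] by (simp add: key_def)
  then have b: "arr s ''H'' b = 0" by (auto simp: key_def split: if_splits)
  then show "b \<notin> supp s ''H''" by (simp add: supp_def)
  fix w assume "w \<in> supp s ''R'' - supp s ''H''"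
  then have "w \<in> supp s ''R''" "arr s ''H'' w = 0" by (auto simp: supp_def)
  then show "degree_in tri (active s) (supp s ''R'') b \<le> degree_in tri (active s) (supp s ''R'') w"
    using assms(2)[of w] b by (simp add: key_def)
qed (use assms(1) in auto)

text \<open>The contents of \<open>''D''\<close> stay arbitrary up to a bound: peeling supplies
  fresh keys, \<open>select_heavy\<close> degrees that are not updated.\<close>

lemma terminates_drop_min:
  assumes "input s" "supp s ''R'' \<noteq> {}" "\<And>i. i < n \<Longrightarrow> arr s ''D'' i < m + (m + 2)"
  shows "terminates N drop_min s (\<lambda>s'. same_except drop_min s s' \<and> reg s' ''r'' = reg s ''r'' - 1 \<and>
    (\<exists>b\<in>supp s ''R''. supp s' ''R'' = supp s ''R'' - {b} \<and>
       (\<forall>u\<in>supp s ''R''. arr s ''D'' b \<le> arr s ''D'' u)))"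
proof -
  \<comment> \<open>As long as \<open>''l''\<close> has its initial value, \<open>''v''\<close>
    carries no information, hence the guard.\<close>
  let ?P = "\<lambda>i s'. (\<forall>j<i. arr s ''R'' j \<noteq> 0 \<longrightarrow> reg s' ''l'' \<le> arr s ''D'' j) \<and>
    (reg s' ''l'' < m + (m + 2) \<longrightarrow> reg s' ''v'' < i \<and> arr s ''R'' (reg s' ''v'') \<noteq> 0 \<and>
       arr s ''D'' (reg s' ''v'') = reg s' ''l'')"
  have n: "reg s ''n'' = n" "reg s ''m'' = m" using assms(1) by (simp_all add: input_def)
  have "terminates N drop_min s (\<lambda>s'. reg s' ''r'' = reg s ''r'' - 1 \<and>
    (\<exists>b\<in>supp s ''R''. supp s' ''R'' = supp s ''R'' - {b} \<and>
       (\<forall>u\<in>supp s ''R''. arr s ''D'' b \<le> arr s ''D'' u)))"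
    unfolding drop_min_def
  proof (rule terminates_Seq, rule terminates_Assign, rule terminates_Seq,
      rule terminates_for_loop[where P = ?P], goal_cases)
    case (6 i s')
    have "arr s' = arr s"
      using same_except_arr[OF 6(4)] by (intro ext) simp
    then show ?case using 6
      by (intro terminates_If terminates_Seq terminates_Assign terminates_Skip)
        (auto simp: less_Suc_eq intro: order.trans order.strict_implies_order)
  next
    case (7 s')
    have a: "arr s' = arr s" using same_except_arr[OF 7(2)] by (intro ext) simp
    have r: "reg s' ''r'' = reg s ''r''" using same_except_reg[OF 7(2), of "''r''"] by simp
    have P: "?P n s'" using 7(1) n by simp
    obtain u where u: "u < n" "arr s ''R'' u \<noteq> 0" using assms(2) by (auto simp: supp_def)
    have "reg s' ''l'' < m + (m + 2)"
      using P u assms(3)[OF u(1)] by (meson le_less_trans)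
    then have v: "reg s' ''v'' < n" "arr s ''R'' (reg s' ''v'') \<noteq> 0"
      "arr s ''D'' (reg s' ''v'') = reg s' ''l''" using P by auto
    show ?case
    proof (rule terminates_Seq, rule terminates_Store, rule terminates_Assign, intro conjI bexI)
      let ?v = "reg s' ''v''"
      show "?v \<in> supp s ''R''" using v by (simp add: supp_def)
      show "\<forall>u\<in>supp s ''R''. arr s ''D'' ?v \<le> arr s ''D'' u" using v P by (simp add: supp_def)
    qed (auto simp: r a supp_def)
  qed (use n size in auto)
  then show ?thesis by (rule terminates_frame)
qed

lemma supp_same: "same_except c s s' \<Longrightarrow> x \<notin> written_arrs c \<Longrightarrow> supp s' x = supp s x"
  by (simp add: supp_def same_except_arr)

lemma active_same: "same_except c s s' \<Longrightarrow> ''g'' \<notin> written_regs c \<Longrightarrow> ''H'' \<notin> written_arrs c \<Longrightarrow>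
  active s' = active s"
  by (simp add: active_def supp_same same_except_reg)

lemma terminates_peel_all:
  assumes "input s"
  shows "terminates N peel_all s (\<lambda>s'. same_except peel_all s s' \<and> card (supp s' ''R'') = k \<and>
    peel tri (active s) (supp s ''H'') {..<n} (supp s' ''R''))"
proof -
  let ?P = "\<lambda>s'. reg s' ''r'' = card (supp s' ''R'') \<and> k \<le> reg s' ''r'' \<and>
    peel tri (active s) (supp s ''H'') {..<n} (supp s' ''R'')"
  have "terminates N peel_all s (\<lambda>s'. card (supp s' ''R'') = k \<and>
      peel tri (active s) (supp s ''H'') {..<n} (supp s' ''R''))"
    unfolding peel_all_def
  proof (rule terminates_Seq, rule terminates_mono, rule terminates_fill[OF assms, where f = "\<lambda>_. 1"])
    fix s1 assume s1: "same_except (fill ''R'' (Num 1)) s s1 \<and> (\<forall>i<n. arr s1 ''R'' i = 1)"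
    then have in1: "input s1" using input_same[of _ s s1] assms by auto
    have ac1: "active s1 = active s" "supp s1 ''H'' = supp s ''H''"
      using active_same[of "fill ''R'' (Num 1)" s s1] supp_same[of "fill ''R'' (Num 1)" s s1] s1
      by simp_all
    have R1: "supp s1 ''R'' = {..<n}" using s1 by (auto simp: supp_def)
    have n1: "reg s1 ''n'' = n" using in1 by (simp add: input_def)
    let ?s = "s1\<lparr>reg := (reg s1)(''r'' := n)\<rparr>"
    have Rs: "supp ?s x = supp s1 x" for x by (simp add: supp_def)
    show "terminates N (Seq (Assign ''r'' (Var ''n''))
      (While (Less (Var ''k'') (Var ''r'')) (Seq count_degrees drop_min))) s1
      (\<lambda>s'. card (supp s' ''R'') = k \<and> peel tri (active s) (supp s ''H'') {..<n} (supp s' ''R''))"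
    proof (rule terminates_Seq, rule terminates_Assign,
        rule terminates_While_frame[where P = ?P and \<mu> = "\<lambda>s. reg s ''r''"], goal_cases)
      case 1
      then show ?case using k_le_n n1 R1 Rs by simp
    next
      case 2
      then show ?case using size n1 by simp
    next
      case (3 s2)
      note r = same_except_reg[OF 3(3)] and a = same_except_arr[OF 3(3)]
      have in2: "input s2" using in1 r a by (simp add: input_def)
      have H2: "supp s2 ''H'' = supp s ''H''" using a ac1(2) by (simp add: supp_def)
      have ac2: "active s2 = active s" using r H2 ac1 unfolding active_def by simp
      have k2: "k < card (supp s2 ''R'')" using 3 in2 by (simp add: input_def)
      show ?case
      proof (rule terminates_Seq, rule terminates_mono, rule terminates_count_degrees[OF in2])
        fix s3 assume s3: "same_except count_degrees s2 s3 \<and> (\<forall>i<n. arr s3 ''D'' i = key s2 i)"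
        then have in3: "input s3" using input_same[of _ s2 s3] in2 by auto
        have R3: "supp s3 ''R'' = supp s2 ''R''" using supp_same[of count_degrees s2 s3] s3 by simp
        have r3: "reg s3 ''r'' = reg s2 ''r''" using same_except_reg[of count_degrees s2 s3] s3 by simp
        have ne: "supp s3 ''R'' \<noteq> {}" using k2 R3 by auto
        have D3: "arr s3 ''D'' i = key s2 i" if "i < n" for i using s3 that by blast
        show "terminates N drop_min s3 (\<lambda>s''. ?P s'' \<and> reg s'' ''r'' < reg s2 ''r'')"
        proof (rule terminates_mono[OF terminates_drop_min[OF in3 ne]])
          fix i assume "i < n"
          then show "arr s3 ''D'' i < m + (m + 2)" using D3 key_less by simp
        next
          fix s4
          assume "same_except drop_min s3 s4 \<and> reg s4 ''r'' = reg s3 ''r'' - 1 \<and>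
            (\<exists>b\<in>supp s3 ''R''. supp s4 ''R'' = supp s3 ''R'' - {b} \<and>
              (\<forall>u\<in>supp s3 ''R''. arr s3 ''D'' b \<le> arr s3 ''D'' u))"
          then obtain b where b: "b \<in> supp s2 ''R''" "supp s4 ''R'' = supp s2 ''R'' - {b}"
            "reg s4 ''r'' = reg s2 ''r'' - 1"
            and mn: "\<And>u. u \<in> supp s2 ''R'' \<Longrightarrow> arr s3 ''D'' b \<le> arr s3 ''D'' u"
            using R3 r3 by auto
          have "key s2 b \<le> key s2 u" if "u \<in> supp s2 ''R''" for u
            using mn[OF that] D3 that b(1) by (simp add: supp_def)
          then have "peel_step tri (active s) (supp s ''H'') (supp s2 ''R'') (supp s4 ''R'')"
            using key_minimal_step[OF b(1)] b(2) ac2 H2 by metis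
          then have "peel tri (active s) (supp s ''H'') {..<n} (supp s4 ''R'')"
            using 3(1) by (meson rtranclp.rtrancl_into_rtrancl)
          moreover have "card (supp s4 ''R'') = reg s4 ''r''"
            using b 3(1) supp_simps by simp
          ultimately show "?P s4 \<and> reg s4 ''r'' < reg s2 ''r''"
            using b k2 3(1) by simp
        qed
      qed
    next
      case (4 s2)
      note r = same_except_reg[OF 4(3)] and a = same_except_arr[OF 4(3)]
      have "input s2" using in1 r a by (simp add: input_def)
      then show ?case using 4 by (simp add: input_def)
    qed
  qed simp_all
  then show ?thesis by (rule terminates_frame)
qed

definition edges_inside :: "nat set \<Rightarrow> nat" where
  "edges_inside R = card (inside tri {..<m} R)"

lemma terminates_offer:
  assumes "input s"
  shows "terminates N offer s (\<lambda>s'. same_except offer s s' \<and>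
    (if reg s ''o'' \<le> edges_inside (supp s ''R'')
     then reg s' ''o'' = Suc (edges_inside (supp s ''R'')) \<and> supp s' ''W'' = supp s ''R''
     else reg s' ''o'' = reg s ''o'' \<and> supp s' ''W'' = supp s ''W''))"
proof -
  let ?J = "inside tri {..<m} (supp s ''R'')"
  have "terminates N offer s (\<lambda>s'.
    (if reg s ''o'' \<le> edges_inside (supp s ''R'')
     then reg s' ''o'' = Suc (edges_inside (supp s ''R'')) \<and> supp s' ''W'' = supp s ''R''
     else reg s' ''o'' = reg s ''o'' \<and> supp s' ''W'' = supp s ''W''))"
    unfolding offer_def
  proof (rule terminates_Seq, rule terminates_Assign, rule terminates_Seq,
      rule terminates_for_loop[where P = "\<lambda>j s'. reg s' ''q'' = Suc (card {l. l < j \<and> l \<in> ?J})"],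
      goal_cases)
    case (6 j s')
    have a: "arr s' = arr s"
      using same_except_arr[OF 6(4)] by (intro ext) simp
    have ins: "input s'"
      using same_except_reg[OF 6(4)] a assms by (simp add: input_def)
    have jm: "j < m" using 6(1) assms by (simp add: input_def)
    show ?case
    proof (rule terminates_Seq, rule terminates_load_edge[OF ins 6(3) jm])
      fix a b c
      assume t: "es ! j = (a, b, c)" "a < n" "b < n" "c < n" "a \<noteq> b" "a \<noteq> c" "b \<noteq> c"
        "tri j = {a, b, c}"
      let ?s = "s'\<lparr>reg := (reg s')(''a'' := a, ''b'' := b, ''c'' := c)\<rparr>"
      have b: "bval edge_inside ?s \<longleftrightarrow> j \<in> ?J"
        using mem_inside[OF jm t(8,2-4) order_refl] jm \<open>arr s' = arr s\<close> by (simp add: edge_inside_def)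
      show "terminates N (If edge_inside (Assign ''q'' (Plus (Var ''q'') (Num 1))) Skip) ?s
          (\<lambda>s''. reg (s''\<lparr>reg := (reg s'')(''j'' := Suc j)\<rparr>) ''q'' =
             Suc (card {l. l < Suc j \<and> l \<in> ?J}))"
        unfolding card_less_Suc_Collect
        by (intro terminates_If terminates_Assign terminates_Skip; unfold b) (use 6(2) in auto)
    qed
  next
    case (7 s')
    have a: "arr s' = arr s" using same_except_arr[OF 7(2)] by (intro ext) simp
    have ins: "input s'"
      using same_except_reg[OF 7(2)] a assms by (simp add: input_def)
    have "{l. l < m \<and> l \<in> ?J} = ?J" by (auto simp: inside_def)
    then have q: "reg s' ''q'' = Suc (edges_inside (supp s ''R''))"
      using 7(1) assms by (simp add: input_def edges_inside_def)
    have o: "reg s' ''o'' = reg s ''o''" using same_except_reg[OF 7(2), of "''o''"] by simp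
    show ?case
    proof (rule terminates_If)
      assume "bval (Less (Var ''o'') (Var ''q'')) s'"
      then have le: "reg s ''o'' \<le> edges_inside (supp s ''R'')" using q o by simp
      let ?s = "s'\<lparr>reg := (reg s')(''o'' := reg s' ''q'')\<rparr>"
      have "input ?s" using ins by (simp add: input_def)
      then have "terminates N (fill ''W'' (Cell ''R'' (Var ''i''))) ?s
        (\<lambda>s''. same_except (fill ''W'' (Cell ''R'' (Var ''i''))) ?s s'' \<and>
           (\<forall>i<n. arr s'' ''W'' i = arr s ''R'' i))"
        by (rule terminates_fill) (auto simp: a dest: same_except_arr[where x = "''R''"])
      then show "terminates N (Seq (Assign ''o'' (Var ''q'')) (fill ''W'' (Cell ''R'' (Var ''i'')))) s'
        (\<lambda>s'. if reg s ''o'' \<le> edges_inside (supp s ''R'')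
              then reg s' ''o'' = Suc (edges_inside (supp s ''R'')) \<and> supp s' ''W'' = supp s ''R''
              else reg s' ''o'' = reg s ''o'' \<and> supp s' ''W'' = supp s ''W'')"
      proof (intro terminates_Seq terminates_Assign, simp only: aval.simps, rule terminates_mono)
        fix s''
        assume *: "same_except (fill ''W'' (Cell ''R'' (Var ''i''))) ?s s'' \<and>
           (\<forall>i<n. arr s'' ''W'' i = arr s ''R'' i)"
        then have "reg s'' ''o'' = reg s' ''q''" using same_except_reg[of _ ?s s'' "''o''"] by force
        moreover have "supp s'' ''W'' = supp s ''R''" using * by (auto simp: supp_def)
        ultimately show "if reg s ''o'' \<le> edges_inside (supp s ''R'')
              then reg s'' ''o'' = Suc (edges_inside (supp s ''R'')) \<and> supp s'' ''W'' = supp s ''R''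
              else reg s'' ''o'' = reg s ''o'' \<and> supp s'' ''W'' = supp s ''W''"
          using le q by simp
      qed
    next
      assume "\<not> bval (Less (Var ''o'') (Var ''q'')) s'"
      then have "\<not> reg s ''o'' \<le> edges_inside (supp s ''R'')" using q o by simp
      then show "terminates N Skip s'
        (\<lambda>s'. if reg s ''o'' \<le> edges_inside (supp s ''R'')
              then reg s' ''o'' = Suc (edges_inside (supp s ''R'')) \<and> supp s' ''W'' = supp s ''R''
              else reg s' ''o'' = reg s ''o'' \<and> supp s' ''W'' = supp s ''W'')"
        using o a by (intro terminates_Skip) (simp add: supp_def)
    qed
  qed (use assms size in \<open>auto simp: input_def\<close>)
  then show ?thesis by (rule terminates_frame)
qed

definition heavy :: "nat set \<Rightarrow> bool" where
  "heavy H \<longleftrightarrow> H \<subseteq> {..<n} \<and> card H = k div 2 \<and>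
     (\<forall>u\<in>{..<n} - H. \<forall>w\<in>H. degree_in tri {..<m} {..<n} u \<le> degree_in tri {..<m} {..<n} w)"

text \<open>With \<open>''g''\<close> nonzero and nothing protected, keys are the degrees in the
  whole hypergraph. Always dropping the lightest vertex keeps every dropped vertex at most as heavy
  as every kept one.\<close>

lemma terminates_select_heavy:
  assumes "input s" "reg s ''g'' \<noteq> 0" "supp s ''H'' = {}"
  shows "terminates N select_heavy s (\<lambda>s'. same_except select_heavy s s' \<and> reg s' ''g'' = 0 \<and>
    heavy (supp s' ''H''))"
proof -
  let ?deg = "degree_in tri {..<m} {..<n}"
  let ?Q = "\<lambda>s'. reg s' ''g'' = 0 \<and> heavy (supp s' ''H'')"
  let ?P = "\<lambda>s'. reg s' ''r'' = card (supp s' ''R'') \<and> k div 2 \<le> reg s' ''r'' \<and>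
    (\<forall>u\<in>{..<n} - supp s' ''R''. \<forall>w\<in>supp s' ''R''. ?deg u \<le> ?deg w)"
  have "terminates N select_heavy s ?Q"
    unfolding select_heavy_def
  proof (rule terminates_Seq, rule terminates_mono, rule terminates_fill[OF assms(1), where f = "\<lambda>_. 1"])
    fix s1 assume s1: "same_except (fill ''R'' (Num 1)) s s1 \<and> (\<forall>i<n. arr s1 ''R'' i = 1)"
    have in1: "input s1" using s1 input_same[of _ s s1] assms(1) by auto
    have H1: "supp s1 ''H'' = {}" using supp_same[of _ s s1 "''H''"] s1 assms(3) by auto
    have g1: "reg s1 ''g'' \<noteq> 0" using same_except_reg[of _ s s1 "''g''"] s1 assms(2) by auto
    let ?s2 = "s1\<lparr>reg := (reg s1)(''r'' := reg s1 ''n'')\<rparr>"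
    have in2: "input ?s2" using in1 by (simp add: input_def)
    have n1: "reg s1 ''n'' = n" using in1 by (simp add: input_def)
    have R2: "supp ?s2 ''R'' = {..<n}" using s1 by (auto simp: supp_def)
    have "active ?s2 = {..<m}" using g1 by (auto simp: active_def)
    then have key2: "key ?s2 i = ?deg i" if "i < n" for i
      using H1 R2 that by (auto simp: key_def supp_def)
    show "terminates N (Seq (Assign ''r'' (Var ''n'')) (Seq count_degrees
     (Seq (While (Less (Var ''k'') (Plus (Var ''r'') (Var ''r''))) drop_min)
     (Seq (fill ''H'' (Cell ''R'' (Var ''i''))) (Assign ''g'' (Num 0)))))) s1 ?Q"
    proof (rule terminates_Seq, rule terminates_Assign, unfold aval.simps, rule terminates_Seq,
        rule terminates_mono, rule terminates_count_degrees[OF in2])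
      fix s3 assume s3: "same_except count_degrees ?s2 s3 \<and> (\<forall>i<n. arr s3 ''D'' i = key ?s2 i)"
      have in3: "input s3" using s3 input_same[of _ ?s2 s3] in2 by auto
      have R3: "supp s3 ''R'' = {..<n}" using supp_same[of _ ?s2 s3 "''R''"] s3 R2 by auto
      have r3: "reg s3 ''r'' = n" using same_except_reg[of _ ?s2 s3 "''r''"] s3 n1 by auto
      have D3: "arr s3 ''D'' i = ?deg i" if "i < n" for i using s3 key2 that by simp
      show "terminates N (Seq (While (Less (Var ''k'') (Plus (Var ''r'') (Var ''r''))) drop_min)
        (Seq (fill ''H'' (Cell ''R'' (Var ''i''))) (Assign ''g'' (Num 0)))) s3 ?Q"
      proof (rule terminates_Seq,
          rule terminates_While_frame[where P = ?P and \<mu> = "\<lambda>s. reg s ''r''"], goal_cases)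
        case 1
        then show ?case using r3 R3 k_le_n by simp
      next
        case 2
        then show ?case using r3 size by simp
      next
        case (3 s4)
        note r = same_except_reg[OF 3(3)] and a = same_except_arr[OF 3(3)]
        have in4: "input s4" using in3 r a by (simp add: input_def)
        have D4: "arr s4 ''D'' i = ?deg i" if "i < n" for i using a D3 that by simp
        have lt: "k < reg s4 ''r'' + reg s4 ''r''" using 3(2) in4 by (simp add: input_def)
        then have ne: "supp s4 ''R'' \<noteq> {}" using 3(1) by auto
        show ?case
        proof (rule terminates_mono[OF terminates_drop_min[OF in4 ne]])
          fix i assume "i < n"
          then show "arr s4 ''D'' i < m + (m + 2)"
            using D4 degree_le_m[of ?s2 "{..<n}" i] \<open>active ?s2 = {..<m}\<close> by simp
        next
          fix s5
          assume *: "same_except drop_min s4 s5 \<and> reg s5 ''r'' = reg s4 ''r'' - 1 \<and>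
            (\<exists>b\<in>supp s4 ''R''. supp s5 ''R'' = supp s4 ''R'' - {b} \<and>
              (\<forall>u\<in>supp s4 ''R''. arr s4 ''D'' b \<le> arr s4 ''D'' u))"
          then obtain b where b: "b \<in> supp s4 ''R''" "supp s5 ''R'' = supp s4 ''R'' - {b}"
            "reg s5 ''r'' = reg s4 ''r'' - 1"
            and mn: "\<And>u. u \<in> supp s4 ''R'' \<Longrightarrow> arr s4 ''D'' b \<le> arr s4 ''D'' u"
            by auto
          have mn': "?deg b \<le> ?deg u" if "u \<in> supp s4 ''R''" for u
            using mn[OF that] D4 that b(1) by (simp add: supp_def)
          have "card (supp s5 ''R'') = reg s5 ''r''" using b 3(1) supp_simps by simp
          moreover have "?deg u \<le> ?deg w" if "u \<in> {..<n} - supp s5 ''R''" "w \<in> supp s5 ''R''" for u w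
            using that b(2) mn'[of w] 3(1) by (cases "u = b") auto
          ultimately show "?P s5 \<and> reg s5 ''r'' < reg s4 ''r''" using b(3) lt by auto
        qed
      next
        case (4 s4)
        note r = same_except_reg[OF 4(3)] and a = same_except_arr[OF 4(3)]
        have in4: "input s4" using in3 r a by (simp add: input_def)
        then have "\<not> k < reg s4 ''r'' + reg s4 ''r''" using 4(2) by (simp add: input_def)
        \<comment> \<open>The invariant gives \<open>k div 2\<close> as a lower bound and the failed
          loop test gives it as an upper bound.\<close>
        then have c4: "card (supp s4 ''R'') = k div 2" using 4(1) by linarith
        show ?case
        proof (rule terminates_Seq, rule terminates_mono,
            rule terminates_fill[OF in4, where f = "arr s4 ''R''"])
          fix i s' assume "same_except (fill ''H'' (Cell ''R'' (Var ''i''))) s4 s'" "reg s' ''i'' = i"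
          then show "aval (Cell ''R'' (Var ''i'')) s' = arr s4 ''R'' i"
            using same_except_arr[of _ s4 s' "''R''"] by auto
        next
          fix s5
          assume "same_except (fill ''H'' (Cell ''R'' (Var ''i''))) s4 s5 \<and>
            (\<forall>i<n. arr s5 ''H'' i = arr s4 ''R'' i)"
          then have "supp (s5\<lparr>reg := (reg s5)(''g'' := 0)\<rparr>) ''H'' = supp s4 ''R''"
            by (auto simp: supp_def)
          then show "terminates N (Assign ''g'' (Num 0)) s5 ?Q"
            using 4(1) c4 supp_simps(2) by (intro terminates_Assign) (simp add: heavy_def)
        qed simp
      qed
    qed
  qed simp_all
  then show ?thesis by (rule terminates_frame)
qed

section \<open>Keeping the best candidate\<close>

definition good :: "state \<Rightarrow> bool" where
  "good s \<longleftrightarrow> reg s ''o'' = Suc (edges_inside (supp s ''W'')) \<and> card (supp s ''W'') = k"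

text \<open>Strict inequality, because it is applied to register \<open>''o''\<close>, one more than
  the best value so far.\<close>

definition found :: "nat set \<Rightarrow> nat set \<Rightarrow> nat \<Rightarrow> bool" where
  "found F H a \<longleftrightarrow> (\<exists>R. peel tri F H {..<n} R \<and> card R = k \<and> edges_inside R < a)"

lemma found_mono: "found F H a \<Longrightarrow> a \<le> b \<Longrightarrow> found F H b"
  by (auto simp: found_def intro: less_le_trans)

text \<open>With \<open>''o''\<close> equal to 0 any candidate is accepted, so \<open>good\<close>
  holds from the first round on; afterwards \<open>''o''\<close> never decreases.\<close>

lemma terminates_peel_round:
  assumes "input s" "reg s ''o'' = 0 \<or> good s"
  shows "terminates N peel_round s (\<lambda>s'. same_except peel_round s s' \<and> good s' \<and>
    reg s ''o'' \<le> reg s' ''o'' \<and> found (active s) (supp s ''H'') (reg s' ''o''))"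
proof -
  have "terminates N peel_round s (\<lambda>s'. good s' \<and>
    reg s ''o'' \<le> reg s' ''o'' \<and> found (active s) (supp s ''H'') (reg s' ''o''))"
    unfolding peel_round_def
  proof (rule terminates_Seq, rule terminates_mono, rule terminates_peel_all[OF assms(1)])
    fix s1
    assume s1: "same_except peel_all s s1 \<and> card (supp s1 ''R'') = k \<and>
      peel tri (active s) (supp s ''H'') {..<n} (supp s1 ''R'')"
    have in1: "input s1" using s1 input_same[of _ s s1] assms(1) by auto
    have o1: "reg s1 ''o'' = reg s ''o''" using same_except_reg[of _ s s1 "''o''"] s1 by auto
    have W1: "supp s1 ''W'' = supp s ''W''" using supp_same[of _ s s1 "''W''"] s1 by auto
    show "terminates N offer s1 (\<lambda>s'. good s' \<and>
      reg s ''o'' \<le> reg s' ''o'' \<and> found (active s) (supp s ''H'') (reg s' ''o''))"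
    proof (rule terminates_mono, rule terminates_offer[OF in1])
      fix s2
      assume "same_except offer s1 s2 \<and>
        (if reg s1 ''o'' \<le> edges_inside (supp s1 ''R'')
         then reg s2 ''o'' = Suc (edges_inside (supp s1 ''R'')) \<and> supp s2 ''W'' = supp s1 ''R''
         else reg s2 ''o'' = reg s1 ''o'' \<and> supp s2 ''W'' = supp s1 ''W'')"
      then have "good s2 \<and> reg s ''o'' \<le> reg s2 ''o'' \<and> edges_inside (supp s1 ''R'') < reg s2 ''o''"
        using s1 o1 W1 assms(2) by (auto simp: good_def split: if_splits)
      then show "good s2 \<and> reg s ''o'' \<le> reg s2 ''o'' \<and> found (active s) (supp s ''H'') (reg s2 ''o'')"
        using s1 by (auto simp: found_def)
    qed
  qed
  then show ?thesis by (rule terminates_frame)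
qed

definition meeting :: "nat set \<Rightarrow> nat set" where
  "meeting H = {j \<in> {..<m}. tri j \<inter> H \<noteq> {}}"

lemma active_zero: "reg s ''g'' = 0 \<Longrightarrow> active s = meeting (supp s ''H'')"
  by (auto simp: active_def meeting_def)

text \<open>Since \<open>''o''\<close> only grows, what \<open>found\<close> says after an early
  round still holds at the end. The three families are those of
  \<open>best_peel_bound\<close>.\<close>

lemma terminates_densest_alg:
  assumes "input s" "reg s ''o'' = 0" "supp s ''H'' = {}"
  shows "terminates N densest_alg s (\<lambda>s'. good s' \<and> found {..<m} {} (reg s' ''o'') \<and>
    (\<exists>H. heavy H \<and> found (meeting H) H (reg s' ''o'')) \<and>
    (\<forall>v<n. found (meeting {v}) {v} (reg s' ''o'')))"
  unfolding densest_alg_def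
proof (rule terminates_Seq, rule terminates_Assign, unfold aval.simps, rule terminates_Seq,
    rule terminates_mono, rule terminates_peel_round, goal_cases)
  case 1
  then show ?case using assms(1) by (simp add: input_def)
next
  case 2
  then show ?case using assms(2) by simp
next
  case (3 s1)
  let ?s0 = "s\<lparr>reg := (reg s)(''g'' := 1)\<rparr>"
  note r = same_except_reg[OF conjunct1[OF 3]] and a = same_except_arr[OF conjunct1[OF 3]]
  have in1: "input s1" using r a assms(1) by (simp add: input_def)
  have H0: "supp ?s0 ''H'' = {}" using assms(3) by (simp add: supp_def)
  have H1: "supp s1 ''H'' = {}" using a assms(3) by (simp add: supp_def)
  have g1: "reg s1 ''g'' \<noteq> 0" using r by simp
  have "active ?s0 = {..<m}" by (auto simp: active_def)
  then have f1: "found {..<m} {} (reg s1 ''o'')" and good1: "good s1" using 3 H0 by auto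
  show ?case
  proof (rule terminates_Seq, rule terminates_mono, rule terminates_select_heavy[OF in1 g1 H1])
    fix s2
    assume s2: "same_except select_heavy s1 s2 \<and> reg s2 ''g'' = 0 \<and> heavy (supp s2 ''H'')"
    note r = same_except_reg[OF conjunct1[OF s2]] and a = same_except_arr[OF conjunct1[OF s2]]
    have in2: "input s2" using r a in1 by (simp add: input_def)
    have o2: "reg s2 ''o'' = reg s1 ''o''" using r by simp
    have good2: "good s2" using good1 r a by (simp add: good_def supp_def)
    have ac2: "active s2 = meeting (supp s2 ''H'')" using s2 active_zero by blast
    show "terminates N (Seq peel_round
     (for_loop ''x'' ''n'' (Seq (fill ''H'' (Num 0)) (Seq (Store ''H'' (Var ''x'') (Num 1))
        peel_round)))) s2 (\<lambda>s'. good s' \<and> found {..<m} {} (reg s' ''o'') \<and>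
    (\<exists>H. heavy H \<and> found (meeting H) H (reg s' ''o'')) \<and>
    (\<forall>v<n. found (meeting {v}) {v} (reg s' ''o'')))"
    proof (rule terminates_Seq, rule terminates_mono, rule terminates_peel_round[OF in2 disjI2[OF good2]])
      fix s3
      assume s3: "same_except peel_round s2 s3 \<and> good s3 \<and>
        reg s2 ''o'' \<le> reg s3 ''o'' \<and> found (active s2) (supp s2 ''H'') (reg s3 ''o'')"
      note r = same_except_reg[OF conjunct1[OF s3]] and a = same_except_arr[OF conjunct1[OF s3]]
      have in3: "input s3" using r a in2 by (simp add: input_def)
      then have n3: "reg s3 ''n'' = n" by (simp add: input_def)
      have g3: "reg s3 ''g'' = 0" using r s2 by simp
      show "terminates N (for_loop ''x'' ''n'' (Seq (fill ''H'' (Num 0))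
          (Seq (Store ''H'' (Var ''x'') (Num 1)) peel_round))) s3
        (\<lambda>s'. good s' \<and> found {..<m} {} (reg s' ''o'') \<and>
          (\<exists>H. heavy H \<and> found (meeting H) H (reg s' ''o'')) \<and>
          (\<forall>v<n. found (meeting {v}) {v} (reg s' ''o'')))"
      \<comment> \<open>Comparing \<open>''o''\<close> with its value before the loop carries over
        the results of the first two rounds.\<close>
      proof (rule terminates_for_loop[where P = "\<lambda>i s'. good s' \<and> reg s3 ''o'' \<le> reg s' ''o'' \<and>
            (\<forall>v<i. found (meeting {v}) {v} (reg s' ''o''))"], goal_cases)
        case 5
        then show ?case using s3 by (simp add: good_def supp_def)
      next
        case (6 i s4)
        note r = same_except_reg[OF 6(4)] and a = same_except_arr[OF 6(4)]
        have in4: "input s4" using r a in3 by (simp add: input_def)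
        have g4: "reg s4 ''g'' = 0" using r g3 by simp
        have i: "i < n" using 6(1) n3 by simp
        show ?case
        proof (rule terminates_Seq, rule terminates_mono,
            rule terminates_fill[OF in4, where f = "\<lambda>_. 0"])
          fix s5
          assume s5: "same_except (fill ''H'' (Num 0)) s4 s5 \<and> (\<forall>i<n. arr s5 ''H'' i = 0)"
          note r = same_except_reg[OF conjunct1[OF s5]] and a = same_except_arr[OF conjunct1[OF s5]]
          let ?s6 = "s5\<lparr>arr := (arr s5)(''H'' := (arr s5 ''H'')(i := 1))\<rparr>"
          have x5: "reg s5 ''x'' = i" using r 6(3) by simp
          have in6: "input ?s6" using r a in4 by (simp add: input_def)
          have good6: "good ?s6" using 6(2) r a by (simp add: good_def supp_def)
          have H6: "supp ?s6 ''H'' = {i}" using s5 i by (auto simp: supp_def)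
          have "active ?s6 = meeting {i}" using active_zero[of ?s6] g4 r H6 by simp
          then have round: "terminates N peel_round ?s6 (\<lambda>s'. same_except peel_round ?s6 s' \<and> good s' \<and>
              reg ?s6 ''o'' \<le> reg s' ''o'' \<and> found (meeting {i}) {i} (reg s' ''o''))"
            using terminates_peel_round[OF in6 disjI2[OF good6]] H6 by simp
          have o5: "reg s5 ''o'' = reg s4 ''o''" using r by simp
          show "terminates N (Seq (Store ''H'' (Var ''x'') (Num 1)) peel_round) s5
            (\<lambda>s'. good (s'\<lparr>reg := (reg s')(''x'' := Suc i)\<rparr>) \<and>
              reg s3 ''o'' \<le> reg (s'\<lparr>reg := (reg s')(''x'' := Suc i)\<rparr>) ''o'' \<and>
              (\<forall>v<Suc i. found (meeting {v}) {v} (reg (s'\<lparr>reg := (reg s')(''x'' := Suc i)\<rparr>) ''o'')))"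
          proof (rule terminates_Seq, rule terminates_Store, unfold aval.simps x5, rule terminates_mono[OF round])
            fix s7
            assume "same_except peel_round ?s6 s7 \<and> good s7 \<and>
              reg ?s6 ''o'' \<le> reg s7 ''o'' \<and> found (meeting {i}) {i} (reg s7 ''o'')"
            then show "good (s7\<lparr>reg := (reg s7)(''x'' := Suc i)\<rparr>) \<and>
              reg s3 ''o'' \<le> reg (s7\<lparr>reg := (reg s7)(''x'' := Suc i)\<rparr>) ''o'' \<and>
              (\<forall>v<Suc i. found (meeting {v}) {v} (reg (s7\<lparr>reg := (reg s7)(''x'' := Suc i)\<rparr>) ''o''))"
              using 6(2) o5 found_mono by (auto simp: good_def supp_def less_Suc_eq)
          qed
        qed simp_all
      next
        case (7 s')
        have "reg s1 ''o'' \<le> reg s' ''o''" "reg s3 ''o'' \<le> reg s' ''o''"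
          using 7(1) s3 o2 by auto
        then have "found {..<m} {} (reg s' ''o'')"
          "found (meeting (supp s2 ''H'')) (supp s2 ''H'') (reg s' ''o'')"
          using f1 s3 ac2 found_mono by auto
        then show ?case using 7(1) n3 s2 by auto
      qed (use n3 size in auto)
    qed
  qed
qed

end

section \<open>The approximation guarantee\<close>

lemma concat_triples_nth:
  "j < length es \<Longrightarrow> es ! j = (concat (map (\<lambda>(a, b, c). [a, b, c]) es) ! (j + (j + j)),
     concat (map (\<lambda>(a, b, c). [a, b, c]) es) ! (j + (j + j) + 1),
     concat (map (\<lambda>(a, b, c). [a, b, c]) es) ! (j + (j + j) + 2))"
proof (induction es arbitrary: j)
  case (Cons t es)
  then show ?case by (cases t; cases j) auto
qed simp

lemma length_concat_triples: "length (concat (map (\<lambda>(a, b, c). [a, b, c]) es)) = 3 * length es"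
  by (induction es) auto

text \<open>The constant 64 works because \<open>64 ^ 5 = 2 ^ 30\<close> exceeds
  \<open>9 * 2 ^ 24\<close>.\<close>

lemma le_root_of_power5:
  fixes x a :: real and n :: nat
  assumes "x ^ 5 \<le> 9 * 2 ^ 24 * real n ^ 4 * a ^ 5" "0 \<le> a"
  shows "x \<le> 64 * real n powr (4 / 5) * a"
proof (rule power_le_imp_le_base[of _ 4])
  have "(real n powr (4 / 5)) ^ 5 = real n ^ 4"
    by (cases "n = 0") (auto simp: powr_power powr_numeral)
  then have "(64 * real n powr (4 / 5) * a) ^ 5 = 2 ^ 30 * real n ^ 4 * a ^ 5"
    by (simp add: power_mult_distrib)
  moreover have "9 * 2 ^ 24 * real n ^ 4 * a ^ 5 \<le> 2 ^ 30 * real n ^ 4 * a ^ 5"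
    using assms(2) by (intro mult_right_mono) auto
  ultimately have "x ^ 5 \<le> (64 * real n powr (4 / 5) * a) ^ 5" using assms(1) by linarith
  then show "x ^ Suc 4 \<le> (64 * real n powr (4 / 5) * a) ^ Suc 4" by simp
qed (use assms(2) in simp)

text \<open>The maximum with 1 covers \<open>n = 0\<close>, where the power is 0.\<close>

definition ratio :: "nat \<Rightarrow> real" where
  "ratio n = max 1 (64 * real n powr (4 / 5))"

lemma ratio_bigo: "ratio \<in> O(\<lambda>n. real n powr (4 / 5))"
proof (rule bigoI[where c = 64])
  show "eventually (\<lambda>n. norm (ratio n) \<le> 64 * norm (real n powr (4 / 5))) sequentially"
    using eventually_ge_at_top[of 1]
  proof eventually_elim
    case (elim n)
    then have "1 \<le> real n powr (4 / 5)" by (intro ge_one_powr_ge_zero) auto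
    then show ?case by (simp add: ratio_def)
  qed
qed

section \<open>From list positions to vertices\<close>

locale presented =
  fixes V :: "'a set" and E :: "'a set set" and k :: nat and vs :: "'a list"
    and es :: "(nat \<times> nat \<times> nat) list"
  assumes hyper: "uniform3_hypergraph V E" and k: "k \<le> card V" and pres: "presents vs es V E"
begin

lemma dist: "distinct vs" and set_vs: "set vs = V"
  and range: "\<And>t. t \<in> set es \<Longrightarrow> triple_set t \<subseteq> {..<length vs}"
  and edges: "edge_of vs ` set es = E" and dist_es: "distinct (map (edge_of vs) es)"
  using pres by (auto simp: presents_def triple_set_def)

lemma card_V: "card V = length vs"
  using dist set_vs distinct_card by fastforce

lemma edge_of_image: "edge_of vs t = (!) vs ` triple_set t"
  by (cases t) (auto simp: edge_of_def triple_set_def)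

lemma inj_nth: "inj_on ((!) vs) {..<length vs}"
  using dist by (simp add: inj_on_def nth_eq_iff_index_eq)

lemma triple_card: "t \<in> set es \<Longrightarrow> card (triple_set t) = 3"
proof -
  assume t: "t \<in> set es"
  then have "card (edge_of vs t) = 3" using hyper edges by (auto simp: uniform3_hypergraph_def)
  then show ?thesis
    using card_image[OF inj_on_subset[OF inj_nth range[OF t]]] by (simp add: edge_of_image)
qed

sublocale run "length vs" k "length vs + length es" es
  using range triple_card k card_V by unfold_locales auto

text \<open>Distinct positions are distinct vertices, so inclusion transfers; each hyperedge is
  listed once, so the counts agree.\<close>

lemma induced_edges_eq:
  assumes "R \<subseteq> {..<length vs}"
  shows "induced_edges E ((!) vs ` R) = edges_inside R"
proof -
  have "set es = (!) es ` {..<m}" by (auto simp: set_conv_nth)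
  then have "E = (\<lambda>j. edge_of vs (es ! j)) ` {..<m}" by (simp add: image_image flip: edges)
  moreover have "edge_of vs (es ! j) \<subseteq> (!) vs ` R \<longleftrightarrow> tri j \<subseteq> R" if "j \<in> {..<m}" for j
  proof -
    have "vs ! x \<in> (!) vs ` R \<longleftrightarrow> x \<in> R" if "x \<in> tri j" for x
      using inj_on_image_mem_iff[OF inj_nth _ assms] range[of "es ! j"] that \<open>j \<in> {..<m}\<close> by auto
    then show ?thesis by (auto simp: edge_of_image image_subset_iff)
  qed
  ultimately have "{e \<in> E. e \<subseteq> (!) vs ` R} = (\<lambda>j. edge_of vs (es ! j)) ` inside tri {..<m} R"
    unfolding inside_def by blast
  moreover have "inj_on (\<lambda>j. edge_of vs (es ! j)) {..<m}"
    using dist_es by (auto simp: inj_on_def distinct_conv_nth)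
  then have "inj_on (\<lambda>j. edge_of vs (es ! j)) (inside tri {..<m} R)"
    by (rule inj_on_subset) (rule inside_subset)
  ultimately show ?thesis by (simp add: induced_edges_def edges_inside_def card_image)
qed

lemma inj_tri: "inj_on tri {..<m}"
proof (rule inj_onI)
  fix i j assume "i \<in> {..<m}" "j \<in> {..<m}" "tri i = tri j"
  moreover from this have "map (edge_of vs) es ! i = map (edge_of vs) es ! j"
    by (simp add: edge_of_image)
  ultimately show "i = j" using nth_eq_iff_index_eq[OF dist_es, of i j] by simp
qed

text \<open>As \<open>k \<le> card V\<close>, the maximum is over a nonempty finite set and is
  attained; an optimal set is then pulled back to positions.\<close>

lemma optimum:
  obtains R where "R \<subseteq> {..<length vs}" "card R = k" "densest_opt V E k = edges_inside R"
proof -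
  let ?S = "{induced_edges E W | W. W \<subseteq> V \<and> card W = k}"
  have fV: "finite V" using hyper by (simp add: uniform3_hypergraph_def)
  have "?S = induced_edges E ` {W. W \<subseteq> V \<and> card W = k}" by auto
  then have "finite ?S" using fV by simp
  moreover obtain W0 where "W0 \<subseteq> V" "card W0 = k" by (rule obtain_subset_with_card_n[OF k])
  then have "?S \<noteq> {}" by blast
  ultimately have "Max ?S \<in> ?S" by (rule Max_in)
  then obtain W where W: "W \<subseteq> V" "card W = k" "densest_opt V E k = induced_edges E W"
    unfolding densest_opt_def by blast
  define R where "R = {i. i < length vs \<and> vs ! i \<in> W}"
  have R: "R \<subseteq> {..<length vs}" by (auto simp: R_def)
  have img: "(!) vs ` R = W"
  proof
    show "W \<subseteq> (!) vs ` R"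
    proof
      fix w assume "w \<in> W"
      moreover from this obtain i where "i < length vs" "vs ! i = w"
        using W(1) set_vs in_set_conv_nth[of w vs] by blast
      ultimately show "w \<in> (!) vs ` R" unfolding R_def by blast
    qed
  qed (auto simp: R_def)
  then have "card R = k" using card_image[OF inj_on_subset[OF inj_nth R]] W(2) by simp
  then show ?thesis using that R W(3) induced_edges_eq[OF R] img by simp
qed

lemma input_input_state: "input (input_state (length vs) es k)"
proof -
  let ?xs = "concat (map (\<lambda>(a, b, c). [a, b, c]) es)"
  have "arr (input_state (length vs) es k) ''E'' i = ?xs ! i" if "i < 3 * m" for i
    using that by (simp add: input_state_def length_concat_triples Let_def)
  then show ?thesis
    using concat_triples_nth[of _ es] by (simp add: input_def) (simp add: input_state_def)
qed

text \<open>Settles \<open>k < 3\<close>, where the optimum is 0 and \<open>best_peel_bound\<close>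
  does not apply.\<close>

lemma edges_inside_small: "R \<subseteq> {..<length vs} \<Longrightarrow> card R < 3 \<Longrightarrow> edges_inside R = 0"
proof -
  assume R: "R \<subseteq> {..<length vs}" "card R < 3"
  have "inside tri {..<m} R = {}"
  proof (rule ccontr)
    assume "inside tri {..<m} R \<noteq> {}"
    then obtain j where "j < m" "tri j \<subseteq> R" by (auto simp: inside_def)
    then have "3 \<le> card R"
      using card_mono[of R "tri j"] triple_card[of "es ! j"] R(1) finite_subset[OF R(1)] by simp
    then show False using R(2) by simp
  qed
  then show ?thesis by (simp add: edges_inside_def)
qed

lemma densest_alg_run:
  obtains t s' where "exec densest_alg (input_state (length vs) es k) t s'"
    "t \<le> cost_bound (length vs + length es) densest_alg"
    "approx_solution (ratio (card V)) V E k (output_set vs s')"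
proof -
  let ?n = "length vs"
  let ?s = "input_state ?n es k"
  have "reg ?s ''o'' = 0" "supp ?s ''H'' = {}" by (auto simp: input_state_def supp_def)
  from terminates_densest_alg[OF input_input_state this] obtain t s'
    where ex: "exec densest_alg ?s t s'" "t \<le> cost_bound (?n + m) densest_alg"
    and post: "good s' \<and> found {..<m} {} (reg s' ''o'') \<and>
      (\<exists>H. heavy H \<and> found (meeting H) H (reg s' ''o'')) \<and>
      (\<forall>v<?n. found (meeting {v}) {v} (reg s' ''o''))"
    by (rule terminatesE)
  from post have good: "good s'" and f1: "found {..<m} {} (reg s' ''o'')"
    and fv: "\<forall>v<?n. found (meeting {v}) {v} (reg s' ''o'')"
    by simp_all
  from post obtain H where H: "heavy H" "found (meeting H) H (reg s' ''o'')" by (elim conjE exE)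
  define a where "a = edges_inside (supp s' ''W'')"
  have o: "reg s' ''o'' = Suc a" and cW: "card (supp s' ''W'') = k"
    using good by (simp_all add: good_def a_def)
  have out: "output_set vs s' = (!) vs ` supp s' ''W''"
    by (auto simp: output_set_def supp_def)
  obtain R where R: "R \<subseteq> {..<?n}" "card R = k" "densest_opt V E k = edges_inside R"
    by (rule optimum)
  have le: "real (densest_opt V E k) \<le> ratio (card V) * a"
  proof (cases "k < 3")
    case True
    then have "densest_opt V E k = 0" using R edges_inside_small by simp
    then show ?thesis by (simp add: ratio_def)
  next
    case False
    obtain R1 where R1: "peel tri {..<m} {} {..<?n} R1" "card R1 = k" "edges_inside R1 < Suc a"
      using f1 o by (auto simp: found_def)
    obtain R2 where R2: "peel tri (meeting H) H {..<?n} R2" "card R2 = k" "edges_inside R2 < Suc a"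
      using H(2) o by (auto simp: found_def)
    have "real (edges_inside R) ^ 5 \<le> 9 * 2 ^ 24 * real ?n ^ 4 * real a ^ 5"
      unfolding edges_inside_def
    proof (rule best_peel_bound[where V = "{..<?n}" and H = H and ?R1.0 = R1 and ?R2.0 = R2])
      show "inj_on tri {..<m}" by (rule inj_tri)
      show "card (tri j) = 3" "tri j \<subseteq> {..<?n}" if "j \<in> {..<m}" for j
        using that triple_card range by auto
      show "peel tri {j \<in> {..<m}. tri j \<inter> H \<noteq> {}} H {..<?n} R2"
        using R2(1) by (simp add: meeting_def)
      show "\<exists>R. peel tri {j \<in> {..<m}. tri j \<inter> {v} \<noteq> {}} {v} {..<?n} R \<and> card R = k \<and>
          card (inside tri {..<m} R) \<le> a" if "v \<in> {..<?n}" for v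
        using fv that o by (auto simp: found_def meeting_def edges_inside_def less_Suc_eq_le)
    qed (use R R1 R2 H(1) False in \<open>auto simp: edges_inside_def heavy_def\<close>)
    then have "real (edges_inside R) \<le> 64 * real ?n powr (4 / 5) * a"
      by (rule le_root_of_power5) simp
    also have "\<dots> \<le> ratio (card V) * a"
      by (intro mult_right_mono) (auto simp: ratio_def card_V)
    finally show ?thesis using R(3) by simp
  qed
  have "0 < ratio (card V)" by (simp add: ratio_def)
  then have "1 / ratio (card V) * real (densest_opt V E k) \<le> a"
    using le by (simp add: field_simps)
  moreover have "induced_edges E (output_set vs s') = a"
    unfolding out a_def by (rule induced_edges_eq) (rule supp_simps)
  moreover have "output_set vs s' \<subseteq> V" using set_vs by (auto simp: output_set_def)
  moreover have "card (output_set vs s') = k"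
    unfolding out using card_image[OF inj_on_subset[OF inj_nth supp_simps(2)]] cW by simp
  ultimately show ?thesis using that[OF ex] by (simp add: approx_solution_def)
qed

end

theorem theorem8:
  shows "\<exists>(alg :: com) (\<rho> :: nat \<Rightarrow> real).
           polynomial_time alg \<and>
           approximates_densest alg \<rho> \<and>
           \<rho> \<in> O(\<lambda>n. real n powr (4 / 5))"
proof (intro exI[of _ densest_alg] exI[of _ ratio] conjI)
  \<comment> \<open>The polynomial depends on the program alone and is fixed before any
    instance.\<close>
  obtain p where p: "cost_bound N densest_alg = poly p N" for N using cost_bound_poly by blast
  show "polynomial_time densest_alg"
    unfolding polynomial_time_def
  proof (intro exI[of _ p] allI impI)
    fix V :: "nat set" and E k vs es
    assume "uniform3_hypergraph V E" "k \<le> card V" "presents vs es V E"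
    then interpret presented V E k vs es by unfold_locales
    show "\<exists>t s'. exec densest_alg (input_state (length vs) es k) t s' \<and>
        t \<le> poly p (length vs + length es)"
      by (rule densest_alg_run) (auto simp flip: p)
  qed
  show "approximates_densest densest_alg ratio"
    unfolding approximates_densest_def
  proof (intro conjI allI impI)
    show "1 \<le> ratio n" for n by (simp add: ratio_def)
    fix V :: "nat set" and E k vs es t s'
    assume *: "uniform3_hypergraph V E" "k \<le> card V" "presents vs es V E"
      and ex: "exec densest_alg (input_state (length vs) es k) t s'"
    interpret presented V E k vs es using * by unfold_locales
    obtain u s'' where "exec densest_alg (input_state (length vs) es k) u s''"
      "approx_solution (ratio (card V)) V E k (output_set vs s'')"
      by (rule densest_alg_run)
    \<comment> \<open>Determinism identifies the given run with the one constructed.\<close>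
    then show "approx_solution (ratio (card V)) V E k (output_set vs s')"
      using exec_deterministic[OF ex] by simp
  qed
qed (rule ratio_bigo)

end
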